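(* (1) Let $p$ be a prime and let $(B,+,\circ)$ be a finite skew brace such that $(B,\circ)/\operatorname{Ker}(\lambda)$ or $(B,\circ)/\operatorname{Ker}(\lambda^{\operatorname{opp}})$ is a $p$-group. If $P$ is any left ideal of $B$ of $p$-power order, then $B$ has a Sylow $p$-sub-skew brace $P_2$ containing $P$, where moreover $P_2$ is a left ideal of $B$ or of $B^{\operatorname{opp}}$. (2) Let $\pi$ be a set of primes and let $(B,+,\circ)$ be a finite skew brace such that the groups $(B,+)$ and $(B,\circ)$ are soluble and such that $(B,\circ)/\operatorname{Ker}(\lambda)$ or $(B,\circ)/\operatorname{Ker}(\lambda^{\operatorname{opp}})$ is a $\pi$-group. If $P$ is any left ideal of $B$ whose order is a $\pi$-number, then $B$ has a Hall $\pi$-sub-skew brace $P_2$ containing $P$, where moreover $P_2$ is a left ideal of $B$ or of $B^{\operatorname{opp}}$.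
   Context: A skew (left) brace is a triple $(B,+,\circ)$ where $(B,+)$ and $(B,\circ)$ are (not necessarily abelian) groups with $a\circ(b+c)=a\circ b-a+a\circ c$ for all $a,b,c\in B$. The map $\lambda:(B,\circ)\to\operatorname{Aut}(B,+)$, $a\mapsto\lambda_a$, with $\lambda_a(b)=-a+a\circ b$, is a group homomorphism. The opposite skew brace $B^{\operatorname{opp}}$ of $B$ is $(B,+^{\operatorname{opp}},\circ)$, where $a+^{\operatorname{opp}}b=b+a$; its lambda map is denoted $\lambda^{\operatorname{opp}}$, so $\lambda^{\operatorname{opp}}_a(b)=a\circ b-a$ (computed in $(B,+)$). A sub-skew brace of $B$ is a subset that is a subgroup of both $(B,+)$ and $(B,\circ)$. A left ideal of $B$ is a subgroup $L$ of $(B,+)$ with $\lambda_a(L)\subseteq L$ for all $a\in B$ (such an $L$ is a sub-skew brace); a left ideal of $B^{\operatorname{opp}}$ is defined in the same way using $+^{\operatorname{opp}}$ and $\lambda^{\operatorname{opp}}$. A $\pi$-number is a positive integer all of whose prime divisors lie in $\pi$. For a finite skew brace $B$, a Sylow $p$-sub-skew brace (resp. Hall $\pi$-sub-skew brace) is a sub-skew brace whose order is the largest power of $p$ (resp. the largest $\pi$-number) dividing $|B|$. *)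

theory Defs
  imports
    "HOL-Algebra.Coset"
    "HOL-Algebra.Bij"
    "HOL-Algebra.Solvable_Groups"
    "HOL-Computational_Algebra.Primes"
begin

section \<open>Skew braces\<close>

text \<open>A skew brace is a pair of groups on one carrier: \<open>A\<close> is the (not necessarily abelian)
  group written additively in the literature, \<open>M\<close> is the group of the circle operation.\<close>

locale skew_brace = A: group A + M: group M
  for A :: "('a, 'm) monoid_scheme" and M :: "('a, 'n) monoid_scheme" +
  assumes carrier_eq: "carrier M = carrier A"
    and brace_distrib:
      "\<lbrakk>a \<in> carrier A; b \<in> carrier A; c \<in> carrier A\<rbrakk> \<Longrightarrow>
        a \<otimes>\<^bsub>M\<^esub> (b \<otimes>\<^bsub>A\<^esub> c) = (a \<otimes>\<^bsub>M\<^esub> b) \<otimes>\<^bsub>A\<^esub> inv\<^bsub>A\<^esub> a \<otimes>\<^bsub>A\<^esub> (a \<otimes>\<^bsub>M\<^esub> c)"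

definition opp_group :: "('a, 'm) monoid_scheme \<Rightarrow> ('a, 'm) monoid_scheme"
  where "opp_group G = G\<lparr>mult := \<lambda>a b. b \<otimes>\<^bsub>G\<^esub> a\<rparr>"

text \<open>The opposite of the skew brace \<open>(A, M)\<close> is \<open>(opp_group A, M)\<close>, so notions for the opposite
  skew brace are obtained by replacing \<open>A\<close> with \<open>opp_group A\<close>.  The maps \<open>lam A M a\<close> are
  extensional, as elements of \<open>AutoGroup A\<close> are.\<close>

definition lam :: "('a, 'm) monoid_scheme \<Rightarrow> ('a, 'n) monoid_scheme \<Rightarrow> 'a \<Rightarrow> 'a \<Rightarrow> 'a"
  where "lam A M a = (\<lambda>b\<in>carrier A. inv\<^bsub>A\<^esub> a \<otimes>\<^bsub>A\<^esub> (a \<otimes>\<^bsub>M\<^esub> b))"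

definition lam_ker :: "('a, 'm) monoid_scheme \<Rightarrow> ('a, 'n) monoid_scheme \<Rightarrow> 'a set"
  where "lam_ker A M = kernel M (AutoGroup A) (lam A M)"

definition sub_skew_brace :: "'a set \<Rightarrow> ('a, 'm) monoid_scheme \<Rightarrow> ('a, 'n) monoid_scheme \<Rightarrow> bool"
  where "sub_skew_brace S A M \<longleftrightarrow> subgroup S A \<and> subgroup S M"

definition left_ideal :: "'a set \<Rightarrow> ('a, 'm) monoid_scheme \<Rightarrow> ('a, 'n) monoid_scheme \<Rightarrow> bool"
  where "left_ideal L A M \<longleftrightarrow> subgroup L A \<and> (\<forall>a\<in>carrier M. lam A M a ` L \<subseteq> L)"


section \<open>Sylow and Hall sub-skew braces\<close>

definition pi_number :: "nat set \<Rightarrow> nat \<Rightarrow> bool"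
  where "pi_number \<pi> n \<longleftrightarrow> n > 0 \<and> (\<forall>q. prime q \<longrightarrow> q dvd n \<longrightarrow> q \<in> \<pi>)"

definition p_group :: "nat \<Rightarrow> ('a, 'm) monoid_scheme \<Rightarrow> bool"
  where "p_group p G \<longleftrightarrow> group G \<and> (\<exists>k. order G = p ^ k)"

definition pi_group :: "nat set \<Rightarrow> ('a, 'm) monoid_scheme \<Rightarrow> bool"
  where "pi_group \<pi> G \<longleftrightarrow> group G \<and> pi_number \<pi> (order G)"

definition sylow_sub_skew_brace ::
    "nat \<Rightarrow> 'a set \<Rightarrow> ('a, 'm) monoid_scheme \<Rightarrow> ('a, 'n) monoid_scheme \<Rightarrow> bool"
  where "sylow_sub_skew_brace p S A M \<longleftrightarrow>
    sub_skew_brace S A M \<and> card S = Max {d. d dvd order A \<and> (\<exists>k. d = p ^ k)}"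

definition hall_sub_skew_brace ::
    "nat set \<Rightarrow> 'a set \<Rightarrow> ('a, 'm) monoid_scheme \<Rightarrow> ('a, 'n) monoid_scheme \<Rightarrow> bool"
  where "hall_sub_skew_brace \<pi> S A M \<longleftrightarrow>
    sub_skew_brace S A M \<and> card S = Max {d. d dvd order A \<and> pi_number \<pi> d}"


section \<open>Basic facts\<close>

lemma opp_group_simps [simp]:
  "carrier (opp_group G) = carrier G"
  "one (opp_group G) = one G"
  "a \<otimes>\<^bsub>opp_group G\<^esub> b = b \<otimes>\<^bsub>G\<^esub> a"
  by (simp_all add: opp_group_def)

lemma inv_opp_group [simp]: "inv\<^bsub>opp_group G\<^esub> a = inv\<^bsub>G\<^esub> a"
  by (simp add: m_inv_def conj_commute)

lemma (in group) group_opp_group: "group (opp_group G)"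
  by (rule groupI) (auto simp: m_assoc intro: r_inv)

lemma lam_opp:
  "b \<in> carrier A \<Longrightarrow> lam (opp_group A) M a b = (a \<otimes>\<^bsub>M\<^esub> b) \<otimes>\<^bsub>A\<^esub> inv\<^bsub>A\<^esub> a"
  by (simp add: lam_def)

context skew_brace
begin

lemma M_closed: "a \<in> carrier A \<Longrightarrow> b \<in> carrier A \<Longrightarrow> a \<otimes>\<^bsub>M\<^esub> b \<in> carrier A"
  using M.m_closed carrier_eq by simp

lemma skew_brace_opp: "skew_brace (opp_group A) M"
proof -
  interpret O: group "opp_group A" by (rule A.group_opp_group)
  show ?thesis
    by unfold_locales (auto simp: carrier_eq brace_distrib A.m_assoc M_closed)
qed

lemma one_eq: "\<one>\<^bsub>M\<^esub> = \<one>\<^bsub>A\<^esub>"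
proof -
  have [simp]: "\<one>\<^bsub>M\<^esub> \<in> carrier A" using M.one_closed carrier_eq by simp
  have "\<one>\<^bsub>M\<^esub> \<otimes>\<^bsub>M\<^esub> (\<one>\<^bsub>A\<^esub> \<otimes>\<^bsub>A\<^esub> \<one>\<^bsub>A\<^esub>) = inv\<^bsub>A\<^esub> \<one>\<^bsub>M\<^esub>"
    using brace_distrib[of "\<one>\<^bsub>M\<^esub>" "\<one>\<^bsub>A\<^esub>" "\<one>\<^bsub>A\<^esub>"] carrier_eq by simp
  then have "inv\<^bsub>A\<^esub> \<one>\<^bsub>M\<^esub> = \<one>\<^bsub>A\<^esub>" using carrier_eq by simp
  then show ?thesis by (metis A.inv_inv A.inv_one \<open>\<one>\<^bsub>M\<^esub> \<in> carrier A\<close>)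
qed

lemma lam_compose:
  assumes "a \<in> carrier A" "b \<in> carrier A" "x \<in> carrier A"
  shows "lam A M (a \<otimes>\<^bsub>M\<^esub> b) x = lam A M a (lam A M b x)"
proof -
  have [simp]: "a \<otimes>\<^bsub>M\<^esub> inv\<^bsub>A\<^esub> b \<in> carrier A" "a \<otimes>\<^bsub>M\<^esub> b \<in> carrier A" "b \<otimes>\<^bsub>M\<^esub> x \<in> carrier A"
    "a \<otimes>\<^bsub>M\<^esub> (b \<otimes>\<^bsub>M\<^esub> x) \<in> carrier A"
    using assms by (simp_all add: M_closed)
  have "a \<otimes>\<^bsub>M\<^esub> \<one>\<^bsub>A\<^esub> = a" using assms carrier_eq one_eq by (metis M.r_one)
  moreover have "a \<otimes>\<^bsub>M\<^esub> (b \<otimes>\<^bsub>A\<^esub> inv\<^bsub>A\<^esub> b) =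
      (a \<otimes>\<^bsub>M\<^esub> b) \<otimes>\<^bsub>A\<^esub> inv\<^bsub>A\<^esub> a \<otimes>\<^bsub>A\<^esub> (a \<otimes>\<^bsub>M\<^esub> inv\<^bsub>A\<^esub> b)"
    using assms by (intro brace_distrib) auto
  ultimately have "a = (a \<otimes>\<^bsub>M\<^esub> b) \<otimes>\<^bsub>A\<^esub> (inv\<^bsub>A\<^esub> a \<otimes>\<^bsub>A\<^esub> (a \<otimes>\<^bsub>M\<^esub> inv\<^bsub>A\<^esub> b))"
    using assms by (simp add: A.m_assoc)
  then have *: "inv\<^bsub>A\<^esub> (a \<otimes>\<^bsub>M\<^esub> b) \<otimes>\<^bsub>A\<^esub> a = inv\<^bsub>A\<^esub> a \<otimes>\<^bsub>A\<^esub> (a \<otimes>\<^bsub>M\<^esub> inv\<^bsub>A\<^esub> b)"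
    using assms by (metis A.inv_closed A.inv_solve_left A.m_closed
      \<open>a \<otimes>\<^bsub>M\<^esub> inv\<^bsub>A\<^esub> b \<in> carrier A\<close> \<open>a \<otimes>\<^bsub>M\<^esub> b \<in> carrier A\<close>)
  have "lam A M a (lam A M b x) =
      inv\<^bsub>A\<^esub> a \<otimes>\<^bsub>A\<^esub> (a \<otimes>\<^bsub>M\<^esub> inv\<^bsub>A\<^esub> b) \<otimes>\<^bsub>A\<^esub> inv\<^bsub>A\<^esub> a \<otimes>\<^bsub>A\<^esub> (a \<otimes>\<^bsub>M\<^esub> (b \<otimes>\<^bsub>M\<^esub> x))"
    using assms by (simp add: lam_def brace_distrib A.m_assoc)
  also have "\<dots> = inv\<^bsub>A\<^esub> (a \<otimes>\<^bsub>M\<^esub> b) \<otimes>\<^bsub>A\<^esub> (a \<otimes>\<^bsub>M\<^esub> (b \<otimes>\<^bsub>M\<^esub> x))"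
    using assms by (simp add: *[symmetric] A.m_assoc)
  also have "\<dots> = lam A M (a \<otimes>\<^bsub>M\<^esub> b) x"
    using assms carrier_eq by (simp add: lam_def M.m_assoc)
  finally show ?thesis by simp
qed

lemma lam_one: "lam A M \<one>\<^bsub>M\<^esub> = (\<lambda>x\<in>carrier A. x)"
  unfolding lam_def using one_eq carrier_eq
  by (intro restrict_ext) (metis A.inv_one A.l_one M.l_one)

lemma lam_in_auto:
  assumes a: "a \<in> carrier A"
  shows "lam A M a \<in> auto A"
proof -
  have cl: "lam A M c x \<in> carrier A" if "c \<in> carrier A" "x \<in> carrier A" for c x
    using that by (simp add: lam_def M_closed)
  have ia: "inv\<^bsub>M\<^esub> a \<in> carrier A" using a M.inv_closed carrier_eq by simp
  have inverse: "lam A M a (lam A M (inv\<^bsub>M\<^esub> a) x) = x" "lam A M (inv\<^bsub>M\<^esub> a) (lam A M a x) = x"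
    if "x \<in> carrier A" for x
    using that a ia lam_compose[of a "inv\<^bsub>M\<^esub> a" x] lam_compose[of "inv\<^bsub>M\<^esub> a" a x] lam_one carrier_eq
    by simp_all
  have "bij_betw (lam A M a) (carrier A) (carrier A)"
    by (rule bij_betw_byWitness[where f' = "lam A M (inv\<^bsub>M\<^esub> a)"]) (use cl a ia inverse in auto)
  moreover have "lam A M a \<in> hom A A"
    using a cl by (auto simp: hom_def lam_def brace_distrib A.m_assoc M_closed)
  ultimately show ?thesis
    by (simp add: auto_def Bij_def lam_def)
qed

lemma lam_hom: "lam A M \<in> hom M (AutoGroup A)"
proof (rule homI)
  fix a b assume ab: "a \<in> carrier M" "b \<in> carrier M"
  then show "lam A M a \<in> carrier (AutoGroup A)"
    by (simp add: AutoGroup_def carrier_eq lam_in_auto)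
  have "lam A M a \<in> Bij (carrier A)" "lam A M b \<in> Bij (carrier A)"
    using ab lam_in_auto carrier_eq by (auto simp: auto_def)
  moreover have "lam A M (a \<otimes>\<^bsub>M\<^esub> b) = compose (carrier A) (lam A M a) (lam A M b)"
    using ab carrier_eq lam_compose
    by (intro extensionalityI[of _ "carrier A"]) (auto simp: compose_def lam_def[of _ _ "_ \<otimes>\<^bsub>M\<^esub> _"])
  ultimately show "lam A M (a \<otimes>\<^bsub>M\<^esub> b) = lam A M a \<otimes>\<^bsub>AutoGroup A\<^esub> lam A M b"
    by (simp add: AutoGroup_def BijGroup_def)
qed

lemma lam_ker_normal: "lam_ker A M \<lhd> M"
  unfolding lam_ker_def
  using lam_hom A.AutoGroup M.group_axioms
  by (intro group_hom.normal_kernel) (simp add: group_hom_def group_hom_axioms_def)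

end

end

theory Submission
  imports Defs "HOL-Algebra.Sylow"
begin

text \<open>Both parts are instances of one statement about a finite group \<open>S\<close> with the property \<open>D\<^sub>\<pi>\<close>: it
  has a Hall \<open>\<pi>\<close>-subgroup into which every \<open>\<pi>\<close>-subgroup can be conjugated.  By Sylow every finite
  group has \<open>D\<^sub>\<pi>\<close> if \<open>\<pi>\<close> consists of one prime (\<open>hall_dominates_prime\<close>), and by Hall every finite
  soluble group has \<open>D\<^sub>\<pi>\<close> for every \<open>\<pi>\<close> (\<open>hall_dominates_solvable\<close>).

  Suppose that \<open>(B,\<circ>)/Ker(\<lambda>)\<close> is a \<open>\<pi>\<close>-group; it is isomorphic to the image \<open>\<Lambda>\<close> of \<open>\<lambda>\<close>.  Let \<open>S\<close> be the
  semidirect product of \<open>(B,+)\<close> with \<open>\<Lambda>\<close>; it is soluble if both groups of the skew brace are.  The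
  \<open>\<Lambda>\<close>-invariant Hall subgroups of \<open>(B,+)\<close> are cut out by the Hall subgroups of \<open>S\<close> that contain \<open>\<Lambda>\<close>,
  so a Hall subgroup of \<open>S\<close> is wanted that contains \<open>\<Lambda>\<close> and a given \<open>\<pi>\<close>-subgroup \<open>P\<close> of \<open>(B,+)\<close>.  If \<open>P\<close> is a left
  ideal, then \<open>P \<Lambda>\<close> is a \<open>\<pi>\<close>-subgroup and \<open>D\<^sub>\<pi>\<close> applies.  If \<open>P\<close> is a left ideal of the opposite skew
  brace, then \<open>P\<close> is normalized by the pairs \<open>(a, \<lambda>\<^sub>a)\<close>, which together with \<open>\<Lambda>\<close> factorize \<open>S\<close>, so that two
  conjugations can be matched up (\<open>hall_left_ideal_exists\<close>).  The theorem follows by applying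
  this to \<open>B\<close> when the image of \<open>\<lambda>\<close> is a \<open>\<pi>\<close>-group, and to the opposite of \<open>B\<close>, whose opposite is \<open>B\<close>,
  when the image of \<open>\<lambda>\<^sup>o\<^sup>p\<^sup>p\<close> is.

  Hall's theorem is proved for all subgroups of a fixed group at once, along a series of normal
  subgroups with factors of prime power order: existence and conjugacy go up one factor by the
  Frattini argument and Sylow's theorem (\<open>unique_hall_class_extension\<close>), and a \<open>\<pi>\<close>-subgroup \<open>U\<close> is
  embedded in a Hall subgroup by climbing along the products of \<open>U\<close> with the terms of the series
  (\<open>pi_subgroup_le_hall_subgroup\<close>).\<close>


section \<open>Numbers with prescribed prime divisors\<close>

lemma pi_number_mult_iff: "pi_number \<pi> (a * b) \<longleftrightarrow> pi_number \<pi> a \<and> pi_number \<pi> b"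
  by (auto simp: pi_number_def prime_dvd_mult_iff)

lemma pi_number_dvd: "pi_number \<pi> b \<Longrightarrow> a dvd b \<Longrightarrow> pi_number \<pi> a"
  by (auto simp: dvd_def pi_number_mult_iff)

lemma pi_number_prime_power: "prime r \<Longrightarrow> r \<in> \<pi> \<Longrightarrow> pi_number \<pi> (r ^ k)"
  unfolding pi_number_def by (metis prime_dvd_power prime_gt_0_nat primes_dvd_imp_eq zero_less_power)

lemma pi_number_singleton_iff:
  assumes "prime r"
  shows "pi_number {r} n \<longleftrightarrow> (\<exists>k. n = r ^ k)"
proof
  assume n: "pi_number {r} n"
  then have "n > 0" by (simp add: pi_number_def)
  then obtain m k where mk: "\<not> r dvd m" "n = m * r ^ k"
    using assms prime_power_canonical by metis
  have "m = 1"
  proof (rule ccontr)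
    assume "m \<noteq> 1"
    then obtain q where q: "prime q" "q dvd m" by (metis prime_factor_nat)
    then have "q dvd n" using mk by simp
    then have "q = r" using n q by (simp add: pi_number_def)
    with q mk show False by simp
  qed
  with mk show "\<exists>k. n = r ^ k" by auto
next
  assume "\<exists>k. n = r ^ k"
  then show "pi_number {r} n" using pi_number_prime_power[OF assms, of "{r}"] by blast
qed

lemma pi_number_complement_singleton_iff:
  assumes "prime r"
  shows "pi_number (- {r}) n \<longleftrightarrow> \<not> r dvd n"
proof
  assume "\<not> r dvd n"
  moreover from this have "n > 0" by (intro gr0I) simp
  ultimately show "pi_number (- {r}) n" by (auto simp: pi_number_def)
qed (use assms in \<open>auto simp: pi_number_def\<close>)

lemma pi_number_coprime:
  assumes "pi_number \<pi> a" "pi_number (- \<pi>) b"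
  shows "coprime a b"
proof (rule ccontr)
  assume "\<not> coprime a b"
  then obtain q where "prime q" "q dvd a" "q dvd b"
    by (metis coprime_iff_gcd_eq_1 gcd_nat.bounded_iff prime_factor_nat)
  with assms show False by (auto simp: pi_number_def)
qed

text \<open>The largest \<open>\<pi>\<close>-number dividing \<open>n\<close> is recognised by its cofactor having no prime divisor
  in \<open>\<pi>\<close>; this description composes well along chains of subgroups.\<close>

lemma Max_pi_number_dvd:
  assumes d: "pi_number \<pi> d" and n: "n = m * d" and m: "pi_number (- \<pi>) m"
  shows "Max {d. d dvd n \<and> pi_number \<pi> d} = d"
proof (rule Max_eqI)
  have "n > 0" using assms by (simp add: pi_number_def)
  then show "finite {d. d dvd n \<and> pi_number \<pi> d}" by simp
  show "e \<le> d" if "e \<in> {d. d dvd n \<and> pi_number \<pi> d}" for e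
  proof -
    have "e dvd m * d" "coprime e m" using that n m pi_number_coprime by auto
    then have "e dvd d" by (simp add: coprime_dvd_mult_right_iff)
    then show "e \<le> d" using d by (simp add: dvd_imp_le pi_number_def)
  qed
qed (use assms in auto)


section \<open>Conjugates and products of subgroups\<close>

locale finite_group = group +
  assumes finite_carrier: "finite (carrier G)"
begin

definition conj_set :: "'a \<Rightarrow> 'a set \<Rightarrow> 'a set"
  where "conj_set g K = (\<lambda>x. g \<otimes> x \<otimes> inv g) ` K"

lemma inv_mult_cancel:
  "x \<in> carrier G \<Longrightarrow> y \<in> carrier G \<Longrightarrow> inv x \<otimes> (x \<otimes> y) = y"
  "x \<in> carrier G \<Longrightarrow> y \<in> carrier G \<Longrightarrow> x \<otimes> (inv x \<otimes> y) = y"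
  by (simp_all flip: m_assoc)

lemma finite_subgroup: "subgroup K G \<Longrightarrow> finite K"
  using finite_carrier finite_subset subgroup.subset by metis

lemma card_subgroup_pos: "subgroup K G \<Longrightarrow> card K > 0"
  using finite_subgroup subgroup.one_closed by (fastforce simp: card_gt_0_iff)

lemma conj_set_one [simp]: "K \<subseteq> carrier G \<Longrightarrow> conj_set \<one> K = K"
proof -
  assume "K \<subseteq> carrier G"
  then have "conj_set \<one> K = (\<lambda>x. x) ` K"
    unfolding conj_set_def by (intro image_cong) (simp_all add: subset_iff)
  then show ?thesis by simp
qed

lemma conj_set_conj_set:
  "g \<in> carrier G \<Longrightarrow> h \<in> carrier G \<Longrightarrow> K \<subseteq> carrier G \<Longrightarrow>
    conj_set g (conj_set h K) = conj_set (g \<otimes> h) K"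
  unfolding conj_set_def image_image
  by (rule image_cong) (simp_all add: inv_mult_group m_assoc subset_iff)

lemma conj_set_mono: "K \<subseteq> L \<Longrightarrow> conj_set g K \<subseteq> conj_set g L"
  by (auto simp: conj_set_def)

lemma conj_set_Int:
  assumes "g \<in> carrier G" "K \<subseteq> carrier G" "L \<subseteq> carrier G"
  shows "conj_set g (K \<inter> L) = conj_set g K \<inter> conj_set g L"
proof -
  have "inj_on (\<lambda>x. g \<otimes> x \<otimes> inv g) (carrier G)" using assms(1) by (intro inj_onI) simp
  then show ?thesis unfolding conj_set_def using assms(2,3) by (rule inj_on_image_Int)
qed

lemma conj_set_subset_carrier: "g \<in> carrier G \<Longrightarrow> K \<subseteq> carrier G \<Longrightarrow> conj_set g K \<subseteq> carrier G"
  by (auto simp: conj_set_def subset_iff)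

lemma conj_set_inv_cancel:
  "g \<in> carrier G \<Longrightarrow> K \<subseteq> carrier G \<Longrightarrow> conj_set (inv g) (conj_set g K) = K"
  "g \<in> carrier G \<Longrightarrow> K \<subseteq> carrier G \<Longrightarrow> conj_set g (conj_set (inv g) K) = K"
  by (simp_all add: conj_set_conj_set)

lemma conj_set_subset_iff:
  assumes "g \<in> carrier G" "K \<subseteq> carrier G" "L \<subseteq> carrier G"
  shows "conj_set g K \<subseteq> L \<longleftrightarrow> K \<subseteq> conj_set (inv g) L"
proof
  assume "conj_set g K \<subseteq> L"
  from conj_set_mono[OF this, of "inv g"] show "K \<subseteq> conj_set (inv g) L"
    using assms by (simp add: conj_set_inv_cancel)
next
  assume "K \<subseteq> conj_set (inv g) L"
  from conj_set_mono[OF this, of g] show "conj_set g K \<subseteq> L"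
    using assms by (simp add: conj_set_inv_cancel)
qed

lemma card_conj_set:
  assumes "g \<in> carrier G" "K \<subseteq> carrier G"
  shows "card (conj_set g K) = card K"
  unfolding conj_set_def using assms
  by (intro card_image inj_onI) (auto simp: subset_iff)

lemma subgroup_conj_set:
  assumes g: "g \<in> carrier G" and K: "subgroup K G"
  shows "subgroup (conj_set g K) G"
proof -
  interpret K: subgroup K G by fact
  show ?thesis
  proof (rule subgroupI)
    show "conj_set g K \<subseteq> carrier G" using g K.subset by (rule conj_set_subset_carrier)
    show "conj_set g K \<noteq> {}" using K.one_closed unfolding conj_set_def by blast
    fix a b assume "a \<in> conj_set g K" "b \<in> conj_set g K"
    then obtain x y where xy: "x \<in> K" "a = g \<otimes> x \<otimes> inv g" "y \<in> K" "b = g \<otimes> y \<otimes> inv g"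
      by (auto simp: conj_set_def)
    have "inv a = g \<otimes> inv x \<otimes> inv g" using xy g by (simp add: inv_mult_group m_assoc)
    then show "inv a \<in> conj_set g K" using xy by (auto simp: conj_set_def)
    have "a \<otimes> b = g \<otimes> (x \<otimes> y) \<otimes> inv g"
      using xy g by (simp add: m_assoc inv_mult_cancel)
    then show "a \<otimes> b \<in> conj_set g K" using xy by (auto simp: conj_set_def)
  qed
qed

lemma conj_set_member:
  assumes "subgroup K G" "g \<in> K"
  shows "conj_set g K = K"
proof -
  interpret K: subgroup K G by fact
  have "conj_set h K \<subseteq> K" if "h \<in> K" for h using that by (auto simp: conj_set_def)
  then show ?thesis
    by (metis K.m_inv_closed K.mem_carrier K.subset assms(2) conj_set_subset_iff subset_antisym inv_inv)
qed

lemma conj_set_normal: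
  assumes "N \<lhd> G" "g \<in> carrier G"
  shows "conj_set g N = N"
proof -
  have N: "N \<subseteq> carrier G" using assms(1) by (simp add: normal_imp_subgroup subgroup.subset)
  have "conj_set h N \<subseteq> N" if "h \<in> carrier G" for h
    using that assms(1) by (auto simp: conj_set_def normal_inv_iff)
  then show ?thesis
    by (metis N assms(2) conj_set_subset_iff subset_antisym inv_inv inv_closed)
qed

lemma conj_set_eqI:
  assumes "g \<in> carrier G" "K \<subseteq> carrier G" "conj_set g K \<subseteq> K"
  shows "conj_set g K = K"
  using assms card_conj_set finite_carrier by (metis card_subset_eq finite_subset)

lemma card_subgroup_dvd:
  assumes "subgroup K G" "subgroup X G" "K \<subseteq> X"
  shows "card K dvd card X"
proof -
  interpret X: group "G\<lparr>carrier := X\<rparr>" using assms(2) by (rule subgroup_imp_group)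
  have "subgroup K (G\<lparr>carrier := X\<rparr>)" using assms by (simp add: subgroup_incl)
  then show ?thesis using dvd_triv_right[of "card K" "card (rcosets\<^bsub>G\<lparr>carrier := X\<rparr>\<^esub> K)"] X.lagrange[of K]
    by (simp add: order_def)
qed

lemma card_set_mult:
  assumes U: "subgroup U G" and K: "subgroup K G"
  shows "card (U <#> K) * card (U \<inter> K) = card U * card K"
proof -
  interpret U: subgroup U G by fact
  interpret K: subgroup K G by fact
  have fin: "finite (U \<times> K)" using assms finite_subgroup by simp
  have img: "(\<lambda>(u, k). u \<otimes> k) ` (U \<times> K) = U <#> K" by (auto simp: set_mult_def)
  have fib: "card {z \<in> U \<times> K. (\<lambda>(u, k). u \<otimes> k) z = w} = card (U \<inter> K)" if "w \<in> U <#> K" for w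
  proof -
    obtain u k where w: "u \<in> U" "k \<in> K" "w = u \<otimes> k" using \<open>w \<in> U <#> K\<close> by (auto simp: set_mult_def)
    have "bij_betw (\<lambda>x. (u \<otimes> x, inv x \<otimes> k)) (U \<inter> K) {z \<in> U \<times> K. (\<lambda>(u, k). u \<otimes> k) z = w}"
    proof (rule bij_betwI')
      show "(u \<otimes> x, inv x \<otimes> k) = (u \<otimes> y, inv y \<otimes> k) \<longleftrightarrow> x = y" if "x \<in> U \<inter> K" "y \<in> U \<inter> K" for x y
        using that w by auto
      show "(u \<otimes> x, inv x \<otimes> k) \<in> {z \<in> U \<times> K. (\<lambda>(u, k). u \<otimes> k) z = w}" if "x \<in> U \<inter> K" for x
        using that w by (auto simp: m_assoc inv_mult_cancel)
      show "\<exists>x\<in>U \<inter> K. z = (u \<otimes> x, inv x \<otimes> k)" if z: "z \<in> {z \<in> U \<times> K. (\<lambda>(u, k). u \<otimes> k) z = w}" for z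
      proof -
        obtain u' k' where z': "z = (u', k')" "u' \<in> U" "k' \<in> K" "u' \<otimes> k' = u \<otimes> k" using z w by auto
        define x where "x = inv u \<otimes> u'"
        have x: "x = k \<otimes> inv k'"
          unfolding x_def using z' w
          by (metis U.mem_carrier K.mem_carrier inv_closed inv_solve_left inv_solve_right m_assoc m_closed)
        have "x \<in> U" unfolding x_def using z' w by simp
        moreover have "x \<in> K" unfolding x using z' w by simp
        moreover have "u' = u \<otimes> x" unfolding x_def using z' w by (simp add: inv_mult_cancel)
        moreover have "k' = inv x \<otimes> k"
          unfolding x using z' w by (simp add: inv_mult_group m_assoc inv_mult_cancel)
        ultimately show ?thesis using z' by blast
      qed
    qed
    then show ?thesis by (simp add: bij_betw_same_card)
  qed
  have "card U * card K = (\<Sum>z\<in>U \<times> K. 1)" by (simp add: card_cartesian_product)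
  also have "\<dots> = (\<Sum>w\<in>U <#> K. \<Sum>z\<in>{z \<in> U \<times> K. (\<lambda>(u, k). u \<otimes> k) z = w}. 1)"
    using sum.image_gen[OF fin, of "\<lambda>_. 1::nat" "\<lambda>(u, k). u \<otimes> k"] unfolding img by simp
  also have "\<dots> = card (U <#> K) * card (U \<inter> K)" using fib by simp
  finally show ?thesis by simp
qed

lemma set_mult_mono_subgroup:
  assumes "subgroup X G" "U \<subseteq> X" "K \<subseteq> X"
  shows "U <#> K \<subseteq> X"
  using assms by (auto simp: set_mult_def dest: subgroup.m_closed)

lemma subset_set_mult:
  assumes "subgroup U G" "subgroup K G"
  shows "U \<subseteq> U <#> K" "K \<subseteq> U <#> K"
proof -
  interpret U: subgroup U G by fact
  interpret K: subgroup K G by fact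
  show "U \<subseteq> U <#> K"
  proof
    fix u assume "u \<in> U"
    then have "u = u \<otimes> \<one>" by simp
    with \<open>u \<in> U\<close> show "u \<in> U <#> K" unfolding set_mult_def using K.one_closed by blast
  qed
  show "K \<subseteq> U <#> K"
  proof
    fix k assume "k \<in> K"
    then have "k = \<one> \<otimes> k" by simp
    with \<open>k \<in> K\<close> show "k \<in> U <#> K" unfolding set_mult_def using U.one_closed by blast
  qed
qed

lemma subgroup_set_mult:
  assumes U: "subgroup U G" and K: "subgroup K G"
    and norm: "\<And>u. u \<in> U \<Longrightarrow> conj_set u K = K"
  shows "subgroup (U <#> K) G"
proof -
  interpret U: subgroup U G by fact
  interpret K: subgroup K G by fact
  have c: "u \<otimes> k \<otimes> inv u \<in> K" if "u \<in> U" "k \<in> K" for u k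
    using norm[OF that(1)] that(2) by (auto simp: conj_set_def)
  show ?thesis
  proof (rule subgroupI)
    show "U <#> K \<subseteq> carrier G" by (simp add: set_mult_mono_subgroup subgroup_self U.subset K.subset)
    show "U <#> K \<noteq> {}" using subset_set_mult[OF U K] U.one_closed by blast
    fix a b assume "a \<in> U <#> K" "b \<in> U <#> K"
    then obtain u k v l where *: "u \<in> U" "k \<in> K" "a = u \<otimes> k" "v \<in> U" "l \<in> K" "b = v \<otimes> l"
      by (auto simp: set_mult_def)
    have "inv a = inv u \<otimes> (u \<otimes> inv k \<otimes> inv u)"
      using * by (simp add: inv_mult_group m_assoc inv_mult_cancel)
    then show "inv a \<in> U <#> K" using * c[of u "inv k"] unfolding set_mult_def by blast
    have "a \<otimes> b = (u \<otimes> v) \<otimes> ((inv v \<otimes> k \<otimes> inv (inv v)) \<otimes> l)"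
      using * by (simp add: m_assoc inv_mult_cancel)
    then show "a \<otimes> b \<in> U <#> K" using * c[of "inv v" k] unfolding set_mult_def by blast
  qed
qed

text \<open>\<open>XN\<close> lies in \<open>Z\<close>, and \<open>|XN : N| = |X : X \<inter> N|\<close>.\<close>

lemma index_Int_dvd:
  assumes Z: "subgroup Z G" and X: "subgroup X G" "X \<subseteq> Z"
    and N: "subgroup N G" "N \<subseteq> Z" "card Z = n * card N"
    and norm: "\<And>x. x \<in> X \<Longrightarrow> conj_set x N = N"
  obtains f where "f dvd n" "card X = f * card (X \<inter> N)"
proof -
  have XN: "subgroup (X \<inter> N) G" using X(1) N(1) by (rule subgroups_Inter_pair)
  have S: "subgroup (X <#> N) G" using X(1) N(1) norm by (rule subgroup_set_mult)
  obtain f where f: "card X = card (X \<inter> N) * f" using card_subgroup_dvd[OF XN X(1)] by blast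
  have "card (X <#> N) = f * card N"
    using card_set_mult[OF X(1) N(1)] f card_subgroup_pos[OF XN] by (simp add: ac_simps)
  moreover have "card (X <#> N) dvd n * card N"
    using card_subgroup_dvd[OF S Z set_mult_mono_subgroup[OF Z X(2) N(2)]] N(3) by simp
  ultimately have "f dvd n" using card_subgroup_pos[OF N(1)] by simp
  then show thesis using f by (intro that) (simp_all only: mult.commute)
qed

lemma normalizer_subgroup:
  assumes X: "subgroup X G" and K: "subgroup K G"
  shows "subgroup {x \<in> X. conj_set x K = K} G"
proof -
  interpret X: subgroup X G by fact
  interpret K: subgroup K G by fact
  show ?thesis
  proof (rule subgroupI)
    show "{x \<in> X. conj_set x K = K} \<noteq> {}" using K.subset X.one_closed conj_set_one by blast
    fix a b assume ab: "a \<in> {x \<in> X. conj_set x K = K}" "b \<in> {x \<in> X. conj_set x K = K}"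
    show "inv a \<in> {x \<in> X. conj_set x K = K}"
      using ab conj_set_inv_cancel(1)[of a K] K.subset by auto
    show "a \<otimes> b \<in> {x \<in> X. conj_set x K = K}"
      using ab conj_set_conj_set[of a b K] K.subset by auto
  qed auto
qed


section \<open>Hall subgroups\<close>


text \<open>The ambient set \<open>X\<close> is a parameter, so that Hall subgroups of all subgroups of one fixed group
  can be compared without changing the group structure.  For \<open>\<pi> = {r}\<close> these are the Sylow
  subgroups.\<close>

definition hall_subgroup :: "nat set \<Rightarrow> 'a set \<Rightarrow> 'a set \<Rightarrow> bool"
  where "hall_subgroup \<pi> H X \<longleftrightarrow> subgroup H G \<and> H \<subseteq> X \<and> pi_number \<pi> (card H) \<and>
    (\<exists>m. pi_number (- \<pi>) m \<and> card X = m * card H)"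

lemma hall_subgroupD:
  assumes "hall_subgroup \<pi> H X"
  shows "subgroup H G" "H \<subseteq> X" "pi_number \<pi> (card H)"
  using assms by (auto simp: hall_subgroup_def)

lemma card_hall_subgroup:
  assumes "hall_subgroup \<pi> H X"
  shows "card H = Max {d. d dvd card X \<and> pi_number \<pi> d}"
proof -
  obtain m where "pi_number (- \<pi>) m" "card X = m * card H"
    using assms by (auto simp: hall_subgroup_def)
  with assms show ?thesis
    by (intro Max_pi_number_dvd[symmetric]) (auto simp: hall_subgroup_def)
qed

lemma hall_subgroup_conj_set:
  assumes "hall_subgroup \<pi> H X" "subgroup X G" "g \<in> carrier G"
  shows "hall_subgroup \<pi> (conj_set g H) (conj_set g X)"
  using assms subgroup.subset[OF assms(2)]
  by (auto simp: hall_subgroup_def card_conj_set subgroup_conj_set subgroup.subset intro: conj_set_mono[THEN subsetD])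

lemma hall_subgroup_subset:
  assumes H: "hall_subgroup \<pi> H Y" and X: "subgroup X G" "H \<subseteq> X" "X \<subseteq> Y" and Y: "subgroup Y G"
  shows "hall_subgroup \<pi> H X"
proof -
  obtain m where m: "pi_number (- \<pi>) m" "card Y = m * card H"
    using H by (auto simp: hall_subgroup_def)
  have H': "subgroup H G" using H by (rule hall_subgroupD)
  obtain a where a: "card X = card H * a" using card_subgroup_dvd[OF H' X(1,2)] by blast
  obtain b where b: "card Y = card X * b" using card_subgroup_dvd[OF X(1) Y X(3)] by blast
  have "m = a * b" using m a b card_subgroup_pos[OF H'] by simp
  then have "pi_number (- \<pi>) a" using m by (simp add: pi_number_mult_iff)
  then show ?thesis using H X a by (auto simp: hall_subgroup_def mult.commute)
qed

lemma hall_subgroup_trans: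
  assumes "hall_subgroup \<pi> H X" "X \<subseteq> Y" "card Y = c * card X" "pi_number (- \<pi>) c"
  shows "hall_subgroup \<pi> H Y"
proof -
  obtain m where "pi_number (- \<pi>) m" "card X = m * card H"
    using assms(1) by (auto simp: hall_subgroup_def)
  then have "pi_number (- \<pi>) (c * m)" "card Y = c * m * card H"
    using assms by (auto simp: pi_number_mult_iff)
  then show ?thesis using assms unfolding hall_subgroup_def by blast
qed

lemma hall_subgroup_iff_sylow:
  assumes "prime r"
  shows "hall_subgroup {r} R T \<longleftrightarrow>
    subgroup R G \<and> R \<subseteq> T \<and> (\<exists>k. card R = r ^ k) \<and> (\<exists>m. \<not> r dvd m \<and> card T = m * card R)"
  using assms by (auto simp: hall_subgroup_def pi_number_singleton_iff pi_number_complement_singleton_iff)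


section \<open>Sylow's conjugacy theorem\<close>

lemma sylow_subgroup_exists:
  assumes r: "prime r" and T: "subgroup T G"
  obtains R where "hall_subgroup {r} R T"
proof -
  interpret T: group "G\<lparr>carrier := T\<rparr>" using T by (rule subgroup_imp_group)
  obtain m k where mk: "\<not> r dvd m" "card T = m * r ^ k"
    using prime_power_canonical[OF r] card_subgroup_pos[OF T] by metis
  obtain R where R: "subgroup R (G\<lparr>carrier := T\<rparr>)" "card R = r ^ k"
    using sylow_thm[OF r T.is_group, of k m] mk finite_subgroup[OF T]
    by (auto simp: order_def mult.commute)
  then have "subgroup R G" "R \<subseteq> T"
    using incl_subgroup[OF T] subgroup.subset by fastforce+
  with R mk have "hall_subgroup {r} R T" unfolding hall_subgroup_iff_sylow[OF r] by auto
  then show thesis by (rule that)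
qed

text \<open>Count \<open>T\<close> by double cosets \<open>UgR\<close>.  With \<open>V\<close> the conjugate of \<open>U\<close> by the inverse of \<open>g\<close>,
  such a double coset has \<open>|V| |R| / |V \<inter> R|\<close> elements.  If no conjugate of \<open>U\<close> lies in \<open>R\<close>, then
  \<open>|V| / |V \<inter> R|\<close> is always a positive power of \<open>r\<close>, and \<open>r |R|\<close> divides \<open>|T|\<close>, which the choice
  of \<open>R\<close> excludes.\<close>

theorem sylow_subgroup_conj:
  assumes r: "prime r" and T: "subgroup T G" and R: "hall_subgroup {r} R T"
    and U: "subgroup U G" "U \<subseteq> T" "card U = r ^ k"
  shows "\<exists>g\<in>T. conj_set g U \<subseteq> R"
proof (rule ccontr)
  assume contr: "\<not> (\<exists>g\<in>T. conj_set g U \<subseteq> R)"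
  interpret T: subgroup T G by fact
  interpret U: subgroup U G by fact
  have R': "subgroup R G" "R \<subseteq> T" using R by (simp_all add: hall_subgroupD)
  interpret R: subgroup R G by fact
  define D where "D g = (\<Union>u\<in>U. \<Union>s\<in>R. {u \<otimes> g \<otimes> s})" for g
  have D_sub: "D g \<subseteq> T" if "g \<in> T" for g using that U R' by (auto simp: D_def)
  have D_self: "g \<in> D g" if "g \<in> T" for g
  proof -
    have "g = \<one> \<otimes> g \<otimes> \<one>" using that by simp
    then show ?thesis unfolding D_def using U.one_closed R.one_closed by blast
  qed
  have D_mono: "D h \<subseteq> D g" if "h \<in> D g" "g \<in> T" for g h
  proof
    fix x assume "x \<in> D h"
    then obtain u s v t where *: "u \<in> U" "s \<in> R" "v \<in> U" "t \<in> R" "x = v \<otimes> (u \<otimes> g \<otimes> s) \<otimes> t"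
      using \<open>h \<in> D g\<close> by (auto simp: D_def)
    then have "x = (v \<otimes> u) \<otimes> g \<otimes> (s \<otimes> t)" using \<open>g \<in> T\<close> by (simp add: m_assoc)
    then show "x \<in> D g" using * unfolding D_def by blast
  qed
  have D_sym: "g \<in> D h" if "h \<in> D g" "g \<in> T" for g h
  proof -
    obtain u s where *: "u \<in> U" "s \<in> R" "h = u \<otimes> g \<otimes> s" using \<open>h \<in> D g\<close> by (auto simp: D_def)
    then have "g = inv u \<otimes> h \<otimes> inv s" using \<open>g \<in> T\<close> by (simp add: m_assoc inv_mult_cancel)
    then show ?thesis using * unfolding D_def by blast
  qed
  have dvd: "r * card R dvd card (D g)" if g: "g \<in> T" for g
  proof -
    define V where "V = conj_set (inv g) U"
    have V: "subgroup V G" unfolding V_def using g U by (intro subgroup_conj_set) auto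
    have cV: "card V = r ^ k" unfolding V_def using g U by (simp add: card_conj_set U.subset)
    have "D g = (\<lambda>x. g \<otimes> x) ` (V <#> R)"
    proof -
      have "u \<otimes> g \<otimes> s = g \<otimes> ((inv g \<otimes> u \<otimes> inv (inv g)) \<otimes> s)" if "u \<in> U" "s \<in> R" for u s
        using that g by (simp add: m_assoc inv_mult_cancel)
      then show ?thesis
        unfolding D_def V_def conj_set_def set_mult_def image_UN by simp
    qed
    moreover have "inj_on (\<lambda>x. g \<otimes> x) (V <#> R)"
      using g set_mult_closed[OF subgroup.subset[OF V] R.subset] by (intro inj_onI) (auto simp: subset_iff)
    ultimately have cD: "card (D g) = card (V <#> R)" by (simp add: card_image)
    have "card (V \<inter> R) dvd r ^ k"
      using card_subgroup_dvd[OF subgroups_Inter_pair[OF V R'(1)] V] cV by auto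
    then obtain j where j: "j \<le> k" "card (V \<inter> R) = r ^ j"
      using r by (auto simp: divides_primepow_nat)
    have "j \<noteq> k"
    proof
      assume "j = k"
      then have "V \<inter> R = V" using j cV finite_subgroup[OF V] by (intro card_subset_eq) auto
      then have "V \<subseteq> R" by blast
      moreover have "inv g \<in> T" using g by simp
      ultimately show False using contr unfolding V_def by blast
    qed
    with j obtain i where i: "k = Suc i + j" by (metis add.commute less_iff_Suc_add le_neq_implies_less add_Suc_right)
    have "card (V <#> R) * r ^ j = (r * r ^ i * card R) * r ^ j"
      using card_set_mult[OF V R'(1)] j cV i by (simp add: power_add mult_ac)
    then have "card (V <#> R) = r * card R * r ^ i" using r by (simp add: prime_gt_0_nat)
    then show ?thesis using cD by simp
  qed
  have "r * card R dvd card (\<Union>(D ` T))"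
  proof (rule dvd_partition)
    show "finite (\<Union>(D ` T))" using D_sub finite_subgroup[OF T] by (meson UN_least finite_subset)
    show "\<forall>c\<in>D ` T. r * card R dvd card c" using dvd by blast
    show "\<forall>c\<in>D ` T. \<forall>d\<in>D ` T. c \<noteq> d \<longrightarrow> c \<inter> d = {}"
    proof (intro ballI impI; rule ccontr)
      fix c d assume "c \<in> D ` T" "d \<in> D ` T" "c \<noteq> d" "c \<inter> d \<noteq> {}"
      then obtain g h x where *: "g \<in> T" "h \<in> T" "c = D g" "d = D h" "x \<in> D g" "x \<in> D h" by blast
      then have "x \<in> T" using D_sub by blast
      with * D_mono D_sym have "D g = D x" "D h = D x" by (meson subset_antisym)+
      with * \<open>c \<noteq> d\<close> show False by simp
    qed
  qed
  moreover have "\<Union>(D ` T) = T" using D_sub D_self by blast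
  moreover obtain m where m: "\<not> r dvd m" "card T = m * card R"
    using R hall_subgroup_iff_sylow[OF r] by auto
  ultimately have "r dvd m" using card_subgroup_pos[OF R'(1)] by simp
  with m show False by simp
qed


section \<open>Hall's theorem\<close>


text \<open>The index \<open>|N : H \<inter> N| = |HN : H|\<close> divides \<open>|X : H|\<close>.\<close>

lemma hall_subgroup_Int_normal:
  assumes X: "subgroup X G" and H: "hall_subgroup \<pi> H X" and N: "subgroup N G" "N \<subseteq> X"
    and norm: "\<And>x. x \<in> X \<Longrightarrow> conj_set x N = N"
  shows "hall_subgroup \<pi> (H \<inter> N) N"
proof -
  note H' = hall_subgroupD[OF H]
  have HN: "subgroup (H \<inter> N) G" using H'(1) N(1) by (rule subgroups_Inter_pair)
  have S: "subgroup (H <#> N) G"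
    using H' N norm by (intro subgroup_set_mult) auto
  have sub: "H \<subseteq> H <#> N" "H <#> N \<subseteq> X"
    using subset_set_mult(1)[OF H'(1) N(1)] set_mult_mono_subgroup[OF X H'(2) N(2)] by auto
  obtain m where m: "pi_number (- \<pi>) m" "card (H <#> N) = m * card H"
    using hall_subgroup_subset[OF H S sub X] by (auto simp: hall_subgroup_def)
  have "card N = m * card (H \<inter> N)"
    using card_set_mult[OF H'(1) N(1)] m(2) card_subgroup_pos[OF H'(1)] by (simp add: ac_simps)
  moreover have "pi_number \<pi> (card (H \<inter> N))"
    using card_subgroup_dvd[OF HN H'(1)] H'(3) pi_number_dvd by blast
  ultimately show ?thesis using HN m(1) by (auto simp: hall_subgroup_def)
qed

text \<open>The indices of \<open>H\<close> and \<open>X\<close> in \<open>Y\<close> are coprime.  Hence \<open>|Y : H|\<close> divides \<open>|X : H \<inter> X|\<close>,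
  while \<open>|X : H \<inter> X| |H| = |HX| \<le> |Y|\<close> gives the opposite inequality.\<close>

lemma hall_subgroup_Int_pi_index:
  assumes X: "subgroup X G" and Y: "subgroup Y G" "X \<subseteq> Y" and H: "hall_subgroup \<pi> H Y"
    and c: "card Y = c * card X" "pi_number \<pi> c"
  shows "hall_subgroup \<pi> (H \<inter> X) X"
proof -
  note H' = hall_subgroupD[OF H]
  have HX: "subgroup (H \<inter> X) G" using H'(1) X by (rule subgroups_Inter_pair)
  obtain m where m: "pi_number (- \<pi>) m" "card Y = m * card H"
    using H by (auto simp: hall_subgroup_def)
  obtain f where f: "card H = card (H \<inter> X) * f" using card_subgroup_dvd[OF HX H'(1)] by blast
  obtain n where n: "card X = card (H \<inter> X) * n" using card_subgroup_dvd[OF HX X] by blast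
  have pos: "card (H \<inter> X) > 0" "card H > 0" "card X > 0"
    using card_subgroup_pos HX H'(1) X by auto
  have "c * (card (H \<inter> X) * n) = m * (card (H \<inter> X) * f)" using c m f n by metis
  then have "c * n = m * f" using pos by (metis mult.left_commute mult_left_cancel neq0_conv)
  moreover have "coprime m c" using pi_number_coprime[OF c(2) m(1)] by (simp add: coprime_commute)
  ultimately have "m dvd n" by (metis coprime_dvd_mult_right_iff dvd_triv_left)
  then have "m \<le> n" using n pos by (intro dvd_imp_le) auto
  moreover have "n \<le> m"
  proof -
    have "card (H <#> X) * card (H \<inter> X) = (n * card H) * card (H \<inter> X)"
      using card_set_mult[OF H'(1) X] n by (simp add: ac_simps)
    then have "card (H <#> X) = n * card H" using pos by simp
    moreover have "card (H <#> X) \<le> card Y"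
      using set_mult_mono_subgroup[OF Y(1) H'(2) Y(2)] finite_subgroup[OF Y(1)] by (rule card_mono[rotated])
    ultimately show "n \<le> m" using m pos by simp
  qed
  ultimately have "n = m" by simp
  moreover have "pi_number \<pi> (card (H \<inter> X))"
    using card_subgroup_dvd[OF HX H'(1)] H'(3) pi_number_dvd by blast
  ultimately show ?thesis using HX m(1) n by (auto simp: hall_subgroup_def mult.commute)
qed

text \<open>Hall subgroups of \<open>X\<close> have the same order, so the inclusion amounts to conjugacy.\<close>

definition unique_hall_class :: "nat set \<Rightarrow> 'a set \<Rightarrow> bool"
  where "unique_hall_class \<pi> X \<longleftrightarrow> (\<exists>H. hall_subgroup \<pi> H X) \<and>
    (\<forall>H K. hall_subgroup \<pi> H X \<longrightarrow> hall_subgroup \<pi> K X \<longrightarrow> (\<exists>g\<in>X. conj_set g K \<subseteq> H))"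

text \<open>The index \<open>|H : RN|\<close> is a power of \<open>r\<close> because it divides \<open>|H : N|\<close>, and it is prime to \<open>r\<close>
  because it divides \<open>|H : R|\<close>.\<close>

lemma set_mult_sylow_eq:
  assumes r: "prime r" and N: "subgroup N G" and H: "subgroup H G" "N \<subseteq> H" "card H = r ^ j * card N"
    and R: "hall_subgroup {r} R H" and norm: "\<And>x. x \<in> H \<Longrightarrow> conj_set x N = N"
  shows "R <#> N = H"
proof -
  note R' = hall_subgroupD[OF R]
  have S: "subgroup (R <#> N) G" using R' N norm by (intro subgroup_set_mult) auto
  have sub: "R <#> N \<subseteq> H" using set_mult_mono_subgroup[OF H(1) R'(2) H(2)] .
  obtain e where e: "card H = card (R <#> N) * e" using card_subgroup_dvd[OF S H(1) sub] by blast
  obtain b where b: "\<not> r dvd b" "card H = b * card R"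
    using R hall_subgroup_iff_sylow[OF r] by auto
  obtain x where x: "card (R <#> N) = card N * x"
    using card_subgroup_dvd[OF N S] subset_set_mult(2)[OF R'(1) N] by blast
  obtain y where y: "card (R <#> N) = card R * y"
    using card_subgroup_dvd[OF R'(1) S] subset_set_mult(1)[OF R'(1) N] by blast
  have "card N * (x * e) = card N * r ^ j" using e x H(3) by (metis mult.assoc mult.commute)
  then have "x * e = r ^ j" using card_subgroup_pos[OF N] by simp
  then have "e dvd r ^ j" by (metis dvd_triv_right)
  moreover have "card R * (y * e) = card R * b" using e y b(2) by (metis mult.assoc mult.commute)
  then have "y * e = b" using card_subgroup_pos[OF R'(1)] by simp
  then have "\<not> r dvd e" using b by auto
  ultimately have "e = 1" using r divides_primepow_nat[OF r, of e j]
    by (metis dvd_power gr0I power_0)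
  then show ?thesis using e sub finite_subgroup[OF H(1)] by (intro card_subset_eq) auto
qed

text \<open>If \<open>r \<notin> \<pi>\<close>, then \<open>X\<close> and \<open>N\<close> have the same Hall subgroups.  Let \<open>r \<in> \<pi>\<close>, let \<open>H\<^sub>1\<close> be a Hall subgroup
  of \<open>N\<close>, and let \<open>T\<close> be its normalizer in \<open>X\<close>.  The conjugacy of Hall subgroups in \<open>N\<close> gives \<open>X = NT\<close>
  (the Frattini argument), so a Sylow \<open>r\<close>-subgroup \<open>R\<close> of \<open>T\<close> accounts for the whole \<open>r\<close>-part of
  \<open>|X|\<close>, and \<open>R H\<^sub>1\<close> is a Hall subgroup of \<open>X\<close>.  Conversely, a Hall subgroup of \<open>X\<close> meets \<open>N\<close> in a
  Hall subgroup, which after conjugation is \<open>H\<^sub>1\<close>; then it lies in \<open>T\<close> and has the form \<open>R H\<^sub>1\<close>, so that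
  Sylow's conjugacy theorem in \<open>T\<close> applies.\<close>

lemma unique_hall_class_extension:
  assumes r: "prime r" and X: "subgroup X G" and N: "subgroup N G" "N \<subseteq> X" "card X = r ^ j * card N"
    and norm: "\<And>x. x \<in> X \<Longrightarrow> conj_set x N = N" and uniq: "unique_hall_class \<pi> N"
  shows "unique_hall_class \<pi> X"
proof (cases "r \<in> \<pi>")
  case False
  then have rj: "pi_number (- \<pi>) (r ^ j)" using r by (intro pi_number_prime_power) auto
  have down: "hall_subgroup \<pi> H N" if H: "hall_subgroup \<pi> H X" for H
  proof -
    note H' = hall_subgroupD[OF H]
    have normH: "conj_set x N = N" if "x \<in> H" for x using that H'(2) norm by blast
    obtain f where "f dvd r ^ j" and f: "card H = f * card (H \<inter> N)"
      using index_Int_dvd[OF X H'(1,2) N normH] .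
    moreover have "pi_number \<pi> f" using H'(3) f by (simp add: pi_number_mult_iff)
    ultimately have "f = 1" using pi_number_coprime[OF _ rj, of f] by (metis coprime_absorb_left nat_dvd_1_iff_1)
    then have "H \<inter> N = H" using f finite_subgroup[OF H'(1)] by (intro card_subset_eq) auto
    then show ?thesis using hall_subgroup_subset[OF H N(1) _ N(2) X] by blast
  qed
  show ?thesis
    using uniq down hall_subgroup_trans[OF _ N(2,3) rj] N(2) unfolding unique_hall_class_def by blast
next
  case True
  interpret X: subgroup X G by fact
  show ?thesis unfolding unique_hall_class_def
  proof (intro conjI allI impI)
    obtain H1 where H1: "hall_subgroup \<pi> H1 N" using uniq by (auto simp: unique_hall_class_def)
    note H1' = hall_subgroupD[OF H1]
    define T where "T = {x \<in> X. conj_set x H1 = H1}"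
    have T: "subgroup T G" unfolding T_def using X H1'(1) by (rule normalizer_subgroup)
    have NT: "subgroup (N \<inter> T) G" using N(1) T by (rule subgroups_Inter_pair)
    \<comment> \<open>Frattini argument: an element \<open>x\<close> of \<open>X\<close> moves \<open>H1\<close> to a Hall subgroup of \<open>N\<close>, and an
      element of \<open>N\<close> moves it back.\<close>
    have "X \<subseteq> N <#> T"
    proof
      fix x assume x: "x \<in> X"
      then have "hall_subgroup \<pi> (conj_set x H1) N"
        using hall_subgroup_conj_set[OF H1 N(1), of x] norm by simp
      then obtain y where y: "y \<in> N" "conj_set y (conj_set x H1) \<subseteq> H1"
        using uniq H1 unfolding unique_hall_class_def by blast
      have yx: "y \<in> carrier G" "x \<in> carrier G" using x y N X.subset by auto
      then have "conj_set (y \<otimes> x) H1 = H1"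
        using y subgroup.subset[OF H1'(1)] by (intro conj_set_eqI) (auto simp: conj_set_conj_set)
      then have "y \<otimes> x \<in> T" using x y N by (auto simp: T_def)
      moreover have "x = inv y \<otimes> (y \<otimes> x)" using yx by (simp add: inv_mult_cancel)
      ultimately show "x \<in> N <#> T"
        using y subgroup.m_inv_closed[OF N(1)] unfolding set_mult_def by blast
    qed
    then have NTX: "N <#> T = X"
      using set_mult_mono_subgroup[OF X N(2), of T] by (auto simp: T_def)
    have cT: "card T = r ^ j * card (N \<inter> T)"
    proof -
      have "card N * (r ^ j * card (N \<inter> T)) = card N * card T"
        using card_set_mult[OF N(1) T] NTX N(3) by (metis mult.assoc mult.commute)
      then show ?thesis using card_subgroup_pos[OF N(1)] by simp
    qed
    have H1T: "H1 \<subseteq> N \<inter> T" using H1'(2) N(2) conj_set_member[OF H1'(1)] by (auto simp: T_def)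
    obtain R where R: "hall_subgroup {r} R T" using sylow_subgroup_exists[OF r T] .
    note R' = hall_subgroupD[OF R]
    define H where "H = R <#> H1"
    have H: "subgroup H G"
      unfolding H_def using R' H1'(1) by (intro subgroup_set_mult) (auto simp: T_def)
    have HX: "H \<subseteq> X"
      unfolding H_def using R'(2) H1'(2) N(2) by (intro set_mult_mono_subgroup[OF X]) (auto simp: T_def)
    have "card H dvd card R * card H1"
      using card_set_mult[OF R'(1) H1'(1)] unfolding H_def by (metis dvd_triv_left)
    moreover have "pi_number \<pi> (card R)"
      using R True r by (auto simp: hall_subgroup_iff_sylow pi_number_prime_power)
    ultimately have piH: "pi_number \<pi> (card H)"
      using H1'(3) by (metis pi_number_mult_iff pi_number_dvd)
    obtain m where m: "card X = card H * m" using card_subgroup_dvd[OF H X HX] by blast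
    obtain s where s: "pi_number (- \<pi>) s" "card N = s * card H1"
      using H1 by (auto simp: hall_subgroup_def)
    obtain c where c: "card H = card R * c"
      using card_subgroup_dvd[OF R'(1) H] subset_set_mult(1)[OF R'(1) H1'(1)] unfolding H_def by blast
    obtain d where d: "card H = card H1 * d"
      using card_subgroup_dvd[OF H1'(1) H] subset_set_mult(2)[OF R'(1) H1'(1)] unfolding H_def by blast
    obtain a where a: "\<not> r dvd a" "card T = a * card R"
      using R hall_subgroup_iff_sylow[OF r] by auto
    obtain t where t: "card N = card (N \<inter> T) * t" using card_subgroup_dvd[OF NT N(1)] by blast
    have rt: "\<not> r dvd t"
    proof
      assume "r dvd t"
      have "hall_subgroup \<pi> H1 (N \<inter> T)"
        using H1 NT H1T by (rule hall_subgroup_subset) (use N in auto)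
      then obtain n where "card (N \<inter> T) = n * card H1" by (auto simp: hall_subgroup_def)
      then have "s = n * t" using t s card_subgroup_pos[OF H1'(1)] by simp
      then have "r dvd s" using \<open>r dvd t\<close> by simp
      then show False using s True r by (auto simp: pi_number_def)
    qed
    have "card R * (c * m) = card R * (a * t)"
      using m c N(3) t cT a(2) by (metis mult.assoc mult.commute)
    then have cm: "c * m = a * t" using card_subgroup_pos[OF R'(1)] by simp
    have "card H1 * (d * m) = card H1 * (r ^ j * s)" using m d N(3) s by (metis mult.assoc mult.commute)
    then have dm: "d * m = r ^ j * s" using card_subgroup_pos[OF H1'(1)] by simp
    \<comment> \<open>The equation \<open>cm\<close> keeps the prime \<open>r\<close> out of the index \<open>m\<close>, and \<open>dm\<close> the other primes in \<open>\<pi>\<close>.\<close>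
    have "pi_number (- \<pi>) m" unfolding pi_number_def
    proof (intro conjI allI impI)
      show "m > 0" using m card_subgroup_pos[OF X] by (simp add: gr0I)
      fix q assume q: "prime q" "q dvd m"
      then have "q dvd r ^ j * s" using dm by (metis dvd_mult)
      then have "q dvd r ^ j \<or> q dvd s" using q by (simp add: prime_dvd_mult_iff)
      then have "q = r \<or> q dvd s" using q r by (metis prime_dvd_power primes_dvd_imp_eq)
      moreover have "q dvd a * t" using q cm by (metis dvd_mult)
      then have "q \<noteq> r" using a(1) rt r by (auto simp: prime_dvd_mult_iff)
      ultimately show "q \<in> - \<pi>" using s q by (auto simp: pi_number_def)
    qed
    then show "\<exists>H. hall_subgroup \<pi> H X"
      using H HX piH m by (auto simp: hall_subgroup_def mult.commute)
  next
    fix H K assume H: "hall_subgroup \<pi> H X" and K: "hall_subgroup \<pi> K X"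
    have HN: "hall_subgroup \<pi> (H \<inter> N) N" using X H N(1,2) norm by (rule hall_subgroup_Int_normal)
    have KN: "hall_subgroup \<pi> (K \<inter> N) N" using X K N(1,2) norm by (rule hall_subgroup_Int_normal)
    obtain y where y: "y \<in> N" "conj_set y (K \<inter> N) \<subseteq> H \<inter> N"
      using HN KN uniq unfolding unique_hall_class_def by blast
    have yX: "y \<in> X" using y N by auto
    define K' where "K' = conj_set y K"
    have K': "hall_subgroup \<pi> K' X"
      using hall_subgroup_conj_set[OF K X, of y] conj_set_member[OF X yX] yX by (simp add: K'_def)
    have card_eq: "card B = card C" if "hall_subgroup \<pi> B Y" "hall_subgroup \<pi> C Y" for B C Y
      using card_hall_subgroup[OF that(1)] card_hall_subgroup[OF that(2)] by simp
    define H1 where "H1 = H \<inter> N"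
    note h = hall_subgroupD[OF H] and k = hall_subgroupD[OF K'] and h1 = hall_subgroupD[OF HN, folded H1_def]
    have K'N: "K' \<inter> N = H1"
    proof -
      have "conj_set y (K \<inter> N) = K' \<inter> N"
        using conj_set_Int[of y K N] norm[OF yX] X.mem_carrier[OF yX]
          hall_subgroupD(1)[OF K, THEN subgroup.subset] N(1)[THEN subgroup.subset]
        by (simp add: K'_def)
      moreover have "conj_set y (K \<inter> N) = H1"
        unfolding H1_def using y(2) finite_subgroup[OF N(1)]
        using card_eq[OF hall_subgroup_conj_set[OF KN N(1)], of y "H \<inter> N"] HN yX norm
        by (intro card_subset_eq) auto
      ultimately show ?thesis by simp
    qed
    define T where "T = {x \<in> X. conj_set x H1 = H1}"
    have T: "subgroup T G" unfolding T_def using X h1(1) by (rule normalizer_subgroup)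
    have norm1: "conj_set x H1 = H1" if Y: "hall_subgroup \<pi> Y X" "Y \<inter> N = H1" and x: "x \<in> Y" for x Y
    proof (rule conj_set_eqI)
      note Y' = hall_subgroupD[OF Y(1)]
      show "x \<in> carrier G" using Y' x X.subset by auto
      show "H1 \<subseteq> carrier G" using h1(1) by (rule subgroup.subset)
      have "conj_set x H1 \<subseteq> Y" "conj_set x H1 \<subseteq> N"
        using conj_set_mono[of H1 Y x] conj_set_mono[of H1 N x] Y Y' x norm[of x] conj_set_member[of Y x] h1(2) by auto
      then show "conj_set x H1 \<subseteq> H1" using Y by auto
    qed
    have HT: "H \<subseteq> T" and KT: "K' \<subseteq> T"
      using norm1[OF H] norm1[OF K' K'N] h k by (auto simp: T_def H1_def)
    have sylow: "\<exists>R. hall_subgroup {r} R T \<and> R \<subseteq> Y \<and> R <#> H1 = Y"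
      if Y: "hall_subgroup \<pi> Y X" "Y \<inter> N = H1" "Y \<subseteq> T" for Y
    proof -
      note Y' = hall_subgroupD[OF Y(1)]
      obtain R where R: "hall_subgroup {r} R Y" using sylow_subgroup_exists[OF r Y'(1)] .
      have "hall_subgroup \<pi> Y T" using Y(1) T Y(3) _ X by (rule hall_subgroup_subset) (auto simp: T_def)
      then obtain n where n: "pi_number (- \<pi>) n" "card T = n * card Y" by (auto simp: hall_subgroup_def)
      then have "pi_number (- {r}) n" using True by (auto simp: pi_number_def)
      then have "hall_subgroup {r} R T" using hall_subgroup_trans[OF R Y(3) n(2)] by simp
      moreover have "\<exists>i. card Y = r ^ i * card H1"
      proof -
        have normY: "conj_set x N = N" if "x \<in> Y" for x using that Y'(2) norm by blast
        obtain f where "f dvd r ^ j" and f: "card Y = f * card (Y \<inter> N)"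
          using index_Int_dvd[OF X Y'(1,2) N normY] .
        then show ?thesis using Y(2) r by (auto simp: divides_primepow_nat)
      qed
      then have "R <#> H1 = Y"
        using set_mult_sylow_eq[OF r h1(1) Y'(1) _ _ R norm1[OF Y(1,2)]] Y(2) by blast
      ultimately show ?thesis using hall_subgroupD[OF R] by blast
    qed
    obtain R where R: "hall_subgroup {r} R T" "R \<subseteq> H"
      using sylow[OF H H1_def[symmetric] HT] by blast
    obtain S where S: "hall_subgroup {r} S T" "S <#> H1 = K'"
      using sylow[OF K' K'N KT] by blast
    obtain i where "card S = r ^ i" using S hall_subgroup_iff_sylow[OF r] by auto
    then obtain t where t: "t \<in> T" "conj_set t S \<subseteq> R"
      using sylow_subgroup_conj[OF r T R(1), of S] hall_subgroupD[OF S(1)] by blast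
    have tX: "t \<in> X" using t by (simp add: T_def)
    have "conj_set t K' \<subseteq> H"
    proof
      fix z assume "z \<in> conj_set t K'"
      then obtain s u where su: "s \<in> S" "u \<in> H1" "z = t \<otimes> (s \<otimes> u) \<otimes> inv t"
        using S(2) by (auto simp: conj_set_def set_mult_def)
      have car: "t \<in> carrier G" "s \<in> carrier G" "u \<in> carrier G"
        using tX su hall_subgroupD[OF S(1)] h1 by (auto dest: subgroup.mem_carrier)
      then have "z = (t \<otimes> s \<otimes> inv t) \<otimes> (t \<otimes> u \<otimes> inv t)"
        using su by (simp add: m_assoc inv_mult_cancel)
      moreover have "t \<otimes> s \<otimes> inv t \<in> H" using t su R by (auto simp: conj_set_def)
      moreover have "t \<otimes> u \<otimes> inv t \<in> conj_set t H1" using su by (auto simp: conj_set_def)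
      then have "t \<otimes> u \<otimes> inv t \<in> H" using t by (auto simp: T_def H1_def)
      ultimately show "z \<in> H" using subgroup.m_closed[OF h(1)] by simp
    qed
    then have "conj_set (t \<otimes> y) K \<subseteq> H"
      using tX yX hall_subgroupD[OF K] by (simp add: K'_def conj_set_conj_set subgroup.subset)
    then show "\<exists>g\<in>X. conj_set g K \<subseteq> H" using tX yX by blast
  qed
qed

text \<open>All terms of the series are normal in the whole group, not only in the next term: then \<open>UN\<close> is a
  subgroup for every subgroup \<open>U\<close> and every term \<open>N\<close>.\<close>

inductive prime_power_series :: "'a set \<Rightarrow> bool" where
  one: "prime_power_series {\<one>}"
| step: "\<lbrakk>prime_power_series N; L \<lhd> G; N \<subseteq> L; prime r; card L = r ^ k * card N\<rbrakk>
    \<Longrightarrow> prime_power_series L"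

lemma prime_power_series_normal: "prime_power_series N \<Longrightarrow> N \<lhd> G"
  by (induction rule: prime_power_series.induct) (simp_all add: one_is_normal)

lemma card_Int_prime_power_index:
  assumes X: "subgroup X G" "X \<subseteq> L" and L: "subgroup L G" and N: "N \<lhd> G" "N \<subseteq> L"
    and r: "prime r" "card L = r ^ k * card N"
  shows "\<exists>j. card X = r ^ j * card (X \<inter> N)"
proof -
  have norm: "conj_set x N = N" if "x \<in> X" for x
    using that X(1) conj_set_normal[OF N(1)] by (simp add: subgroup.mem_carrier)
  obtain f where "f dvd r ^ k" "card X = f * card (X \<inter> N)"
    using index_Int_dvd[OF L X normal_imp_subgroup[OF N(1)] N(2) r(2) norm] .
  then show ?thesis using r(1) by (auto simp: divides_primepow_nat)
qed

text \<open>The claim covers all subgroups \<open>X\<close> of a term, since conjugacy in subgroups outside the series is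
  used when a \<open>\<pi>\<close>-subgroup is embedded in a Hall subgroup.\<close>

theorem prime_power_series_unique_hall_class:
  assumes "prime_power_series N" "subgroup X G" "X \<subseteq> N"
  shows "unique_hall_class \<pi> X"
  using assms
proof (induction arbitrary: X rule: prime_power_series.induct)
  case one
  then have "X = {\<one>}" using subgroup.one_closed by blast
  moreover have "hall_subgroup \<pi> {\<one>} {\<one>}"
    using one.prems \<open>X = {\<one>}\<close> by (auto simp: hall_subgroup_def pi_number_def)
  moreover have "H = {\<one>}" if "hall_subgroup \<pi> H {\<one>}" for H
    using hall_subgroupD[OF that] subgroup.one_closed by blast
  ultimately show ?case unfolding unique_hall_class_def by force
next
  case (step N L r k)
  have N: "N \<lhd> G" using step.hyps(1) by (rule prime_power_series_normal)
  have L: "subgroup L G" using step.hyps(2) by (rule normal_imp_subgroup)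
  have XN: "subgroup (X \<inter> N) G"
    using step.prems(1) normal_imp_subgroup[OF N] by (rule subgroups_Inter_pair)
  obtain j where j: "card X = r ^ j * card (X \<inter> N)"
    using card_Int_prime_power_index[OF step.prems L N step.hyps(3-5)] by blast
  show ?case
  proof (rule unique_hall_class_extension[OF step.hyps(4) step.prems(1) XN _ j])
    show "conj_set x (X \<inter> N) = X \<inter> N" if "x \<in> X" for x
      using that step.prems(1) N conj_set_Int[of x X N] conj_set_member[of X x] conj_set_normal[of N x]
        normal_imp_subgroup[OF N] by (simp add: subgroup.subset subgroup.mem_carrier)
    show "unique_hall_class \<pi> (X \<inter> N)" using step.IH XN by simp
  qed simp
qed

text \<open>Climb along the chain of the groups \<open>UN\<close>.  The index of \<open>X = UN\<close> in the next group \<open>Y = UL\<close> is a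
  power of a prime \<open>r\<close>.  If \<open>r \<notin> \<pi>\<close>, a Hall subgroup of \<open>X\<close> is one of \<open>Y\<close>.  If \<open>r \<in> \<pi>\<close>, a Hall subgroup
  of \<open>Y\<close> meets \<open>X\<close> in a Hall subgroup, and by conjugacy in \<open>X\<close> every Hall subgroup of \<open>X\<close> arises in
  this way.\<close>

lemma pi_subgroup_le_hall_subgroup:
  assumes G: "prime_power_series (carrier G)" and U: "subgroup U G" "pi_number \<pi> (card U)"
    and N: "prime_power_series N"
  shows "\<exists>H. hall_subgroup \<pi> H (U <#> N) \<and> U \<subseteq> H"
  using N
proof (induction rule: prime_power_series.induct)
  case one
  have "U <#> {\<one>} = U"
    using U(1) subset_set_mult(1)[OF U(1) triv_subgroup]
    by (auto simp: set_mult_def dest: subgroup.mem_carrier)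
  moreover have "hall_subgroup \<pi> U U"
    using U by (auto simp: hall_subgroup_def pi_number_def intro!: exI[of _ 1])
  ultimately show ?case by auto
next
  case (step N L r k)
  have N: "N \<lhd> G" using step.hyps(1) by (rule prime_power_series_normal)
  have L: "subgroup L G" using step.hyps(2) by (rule normal_imp_subgroup)
  have N': "subgroup N G" using N by (rule normal_imp_subgroup)
  define X Y where "X = U <#> N" and "Y = U <#> L"
  have X: "subgroup X G"
    unfolding X_def using U N' conj_set_normal[OF N] by (intro subgroup_set_mult) (auto dest: subgroup.mem_carrier)
  have Y: "subgroup Y G"
    unfolding Y_def using U L conj_set_normal[OF step.hyps(2)] by (intro subgroup_set_mult) (auto dest: subgroup.mem_carrier)
  have XY: "X \<subseteq> Y" unfolding X_def Y_def using step.hyps(3) by (intro mono_set_mult) auto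
  obtain H where H: "hall_subgroup \<pi> H X" "U \<subseteq> H" using step.IH by (auto simp: X_def)
  obtain c where c: "card Y = card X * c" using card_subgroup_dvd[OF X Y XY] by blast
  have UN: "subgroup (U \<inter> N) G" and UL: "subgroup (U \<inter> L) G"
    using U N' L by (auto intro: subgroups_Inter_pair)
  obtain e where e: "card (U \<inter> L) = card (U \<inter> N) * e"
    using card_subgroup_dvd[OF UN UL] step.hyps(3) by blast
  have "(card X * card (U \<inter> N)) * (c * e) = card Y * card (U \<inter> L)"
    using c e by simp
  also have "\<dots> = (card X * card (U \<inter> N)) * r ^ k"
    using card_set_mult[OF U(1) N'] card_set_mult[OF U(1) L] step.hyps(5) unfolding X_def Y_def by simp
  finally have "c * e = r ^ k" using card_subgroup_pos[OF X] card_subgroup_pos[OF UN] by simp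
  then have "c dvd r ^ k" by (metis dvd_triv_left)
  then obtain i where i: "c = r ^ i" using step.hyps(4) by (auto simp: divides_primepow_nat)
  show ?case
  proof (cases "r \<in> \<pi>")
    case False
    then have "pi_number (- \<pi>) c" using i step.hyps(4) by (auto intro: pi_number_prime_power)
    then have "hall_subgroup \<pi> H Y" using hall_subgroup_trans[OF H(1) XY, of c] c by (simp add: mult.commute)
    then show ?thesis using H(2) by (auto simp: Y_def)
  next
    case True
    then have "pi_number \<pi> c" using i step.hyps(4) by (auto intro: pi_number_prime_power)
    moreover have uniq: "unique_hall_class \<pi> Z" if "subgroup Z G" for Z
      using prime_power_series_unique_hall_class[OF G that] that by (simp add: subgroup.subset)
    then obtain K where K: "hall_subgroup \<pi> K Y" using Y unfolding unique_hall_class_def by blast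
    ultimately have "hall_subgroup \<pi> (K \<inter> X) X"
      using hall_subgroup_Int_pi_index[OF X Y XY K, of c] c by (simp add: mult.commute)
    then obtain g where g: "g \<in> X" "conj_set g H \<subseteq> K \<inter> X"
      using uniq[OF X] H(1) unfolding unique_hall_class_def by blast
    have gY: "g \<in> Y" "g \<in> carrier G" using g XY X by (auto dest: subgroup.mem_carrier)
    have "H \<subseteq> conj_set (inv g) K"
      using g gY conj_set_subset_iff[of g H K] hall_subgroupD(1)[OF H(1)] hall_subgroupD(1)[OF K]
      by (auto dest: subgroup.subset)
    moreover have "hall_subgroup \<pi> (conj_set (inv g) K) Y"
      using hall_subgroup_conj_set[OF K Y, of "inv g"] conj_set_member[OF Y, of "inv g"] gY Y
      by (simp add: subgroup.m_inv_closed)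
    ultimately show ?thesis using H(2) by (auto simp: Y_def)
  qed
qed

text \<open>This is the property \<open>D\<^sub>\<pi>\<close> of P. Hall.  Through it the Sylow
  case and the soluble case are treated alike.\<close>

definition hall_dominates :: "nat set \<Rightarrow> bool"
  where "hall_dominates \<pi> \<longleftrightarrow> (\<exists>S. hall_subgroup \<pi> S (carrier G) \<and>
    (\<forall>U. subgroup U G \<longrightarrow> pi_number \<pi> (card U) \<longrightarrow> (\<exists>g\<in>carrier G. conj_set g U \<subseteq> S)))"

theorem hall_dominates_prime:
  assumes "prime r"
  shows "hall_dominates {r}"
proof -
  obtain S where S: "hall_subgroup {r} S (carrier G)"
    using sylow_subgroup_exists[OF assms subgroup_self] .
  moreover have "\<exists>g\<in>carrier G. conj_set g U \<subseteq> S"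
    if "subgroup U G" "pi_number {r} (card U)" for U
    using that sylow_subgroup_conj[OF assms subgroup_self S that(1) subgroup.subset[OF that(1)]]
    by (auto simp: pi_number_singleton_iff[OF assms])
  ultimately show ?thesis unfolding hall_dominates_def by blast
qed

lemma hall_dominates_prime_power_series:
  assumes "prime_power_series (carrier G)"
  shows "hall_dominates \<pi>"
proof -
  have uniq: "unique_hall_class \<pi> (carrier G)"
    using prime_power_series_unique_hall_class[OF assms subgroup_self] by simp
  then obtain S where S: "hall_subgroup \<pi> S (carrier G)" by (auto simp: unique_hall_class_def)
  moreover have "\<exists>g\<in>carrier G. conj_set g U \<subseteq> S"
    if U: "subgroup U G" "pi_number \<pi> (card U)" for U
  proof -
    have "U <#> carrier G = carrier G"
      using subset_set_mult(2)[OF U(1) subgroup_self]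
        set_mult_mono_subgroup[OF subgroup_self subgroup.subset[OF U(1)] subset_refl] by blast
    then obtain H where "hall_subgroup \<pi> H (carrier G)" "U \<subseteq> H"
      using pi_subgroup_le_hall_subgroup[OF assms U assms] by auto
    moreover from this obtain g where "g \<in> carrier G" "conj_set g H \<subseteq> S"
      using uniq S unfolding unique_hall_class_def by blast
    ultimately show ?thesis using conj_set_mono by blast
  qed
  ultimately show ?thesis unfolding hall_dominates_def by blast
qed

text \<open>Take \<open>L = RN\<close> for a Sylow \<open>r\<close>-subgroup \<open>R\<close> of \<open>K\<close>, where \<open>r\<close> divides \<open>|K : N|\<close>.  Since \<open>K / N\<close> is abelian,
  \<open>L\<close> is normal in \<open>K\<close>; since a conjugate of \<open>R\<close> under the whole group is already a conjugate
  under \<open>K\<close>, it lies in \<open>L\<close> again, and so \<open>L\<close> is normal in the whole group.\<close>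

lemma abelian_factor_prime_power_step:
  assumes N: "N \<lhd> G" and K: "K \<lhd> G" "N \<subset> K" and ab: "derived G K \<subseteq> N"
  shows "\<exists>L r k. L \<lhd> G \<and> N \<subset> L \<and> L \<subseteq> K \<and> prime r \<and> card L = r ^ k * card N"
proof -
  have N': "subgroup N G" and K': "subgroup K G" using N K(1) by (simp_all add: normal_imp_subgroup)
  obtain n where n: "card K = card N * n" using card_subgroup_dvd[OF N' K'] K(2) by blast
  have "card N < card K" using K(2) finite_subgroup[OF K'] by (rule psubset_card_mono[rotated])
  then have "n \<noteq> 1" using n by simp
  then obtain r where r: "prime r" "r dvd n" by (metis prime_factor_nat)
  obtain R where R: "hall_subgroup {r} R K" using sylow_subgroup_exists[OF r(1) K'] .
  note R' = hall_subgroupD[OF R]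
  obtain m i where m: "\<not> r dvd m" "card K = m * card R" and i: "card R = r ^ i"
    using R hall_subgroup_iff_sylow[OF r(1)] by auto
  have nR: "\<not> R \<subseteq> N"
  proof
    assume "R \<subseteq> N"
    then obtain a where a: "card N = card R * a" using card_subgroup_dvd[OF R'(1) N'] by blast
    then have "card R * (a * n) = card R * m" using n m by (metis mult.assoc mult.commute)
    then have "a * n = m" using card_subgroup_pos[OF R'(1)] by simp
    then show False using r m by auto
  qed
  define L where "L = R <#> N"
  have L: "subgroup L G"
    unfolding L_def using R' N' conj_set_normal[OF N] by (intro subgroup_set_mult) (auto dest: subgroup.mem_carrier)
  have NL: "N \<subset> L"
    using subset_set_mult[OF R'(1) N'] nR by (auto simp: L_def)
  have LK: "L \<subseteq> K"
    unfolding L_def using R'(2) K by (intro set_mult_mono_subgroup[OF K']) auto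
  have RN: "subgroup (R \<inter> N) G" using R'(1) N' by (rule subgroups_Inter_pair)
  obtain e where e: "card R = card (R \<inter> N) * e" using card_subgroup_dvd[OF RN R'(1)] by blast
  have "card L = e * card N"
    using card_set_mult[OF R'(1) N'] e card_subgroup_pos[OF RN] by (simp add: L_def ac_simps)
  moreover have "e dvd r ^ i" using e i by (metis dvd_triv_right)
  then obtain k where "e = r ^ k" using r(1) by (auto simp: divides_primepow_nat)
  moreover have "L \<lhd> G"
  proof -
    have normK: "conj_set x L \<subseteq> L" if x: "x \<in> K" for x
    proof
      fix z assume "z \<in> conj_set x L"
      then obtain l where l: "l \<in> L" "z = x \<otimes> l \<otimes> inv x" by (auto simp: conj_set_def)
      have car: "x \<in> carrier G" "l \<in> carrier G" using x l K' L by (auto dest: subgroup.mem_carrier)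
      have "x \<otimes> l \<otimes> inv x \<otimes> inv l \<in> derived G K"
        unfolding derived_def using x l LK by (intro generate.incl) blast
      then have "x \<otimes> l \<otimes> inv x \<otimes> inv l \<in> L" using ab NL by blast
      then have "x \<otimes> l \<otimes> inv x \<otimes> inv l \<otimes> l \<in> L" using l L by (simp add: subgroup.m_closed)
      then show "z \<in> L" using l car by (simp add: m_assoc)
    qed
    have "conj_set g L \<subseteq> L" if g: "g \<in> carrier G" for g
    proof -
      have "hall_subgroup {r} (conj_set g R) K"
        using hall_subgroup_conj_set[OF R K' g] conj_set_normal[OF K(1) g] by simp
      then obtain y where y: "y \<in> K" "conj_set y (conj_set g R) \<subseteq> R"
        using sylow_subgroup_conj[OF r(1) K' R, of "conj_set g R" i] i
          card_conj_set[OF g subgroup.subset[OF R'(1)]] hall_subgroupD[of _ "conj_set g R" K] by metis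
      have yc: "y \<in> carrier G" using y K' by (auto dest: subgroup.mem_carrier)
      have "conj_set g R \<subseteq> conj_set (inv y) R"
        using y yc g R'(1) by (subst conj_set_subset_iff[symmetric]) (auto simp: subgroup.subset conj_set_subset_carrier)
      also have "\<dots> \<subseteq> conj_set (inv y) L"
        using subset_set_mult(1)[OF R'(1) N'] unfolding L_def by (rule conj_set_mono)
      also have "\<dots> \<subseteq> L" using normK y K' by (simp add: subgroup.m_inv_closed)
      finally have gR: "conj_set g R \<subseteq> L" .
      have gN: "conj_set g N \<subseteq> L" using conj_set_normal[OF N g] NL by auto
      show ?thesis
      proof
        fix z assume "z \<in> conj_set g L"
        then obtain s u where su: "s \<in> R" "u \<in> N" "z = g \<otimes> (s \<otimes> u) \<otimes> inv g"
          by (auto simp: conj_set_def L_def set_mult_def)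
        have "s \<in> carrier G" "u \<in> carrier G" using su R'(1) N' by (auto dest: subgroup.mem_carrier)
        then have "z = (g \<otimes> s \<otimes> inv g) \<otimes> (g \<otimes> u \<otimes> inv g)"
          using su g by (simp add: m_assoc inv_mult_cancel)
        moreover have "g \<otimes> s \<otimes> inv g \<in> L" using gR su by (auto simp: conj_set_def)
        moreover have "g \<otimes> u \<otimes> inv g \<in> L" using gN su by (auto simp: conj_set_def)
        ultimately show "z \<in> L" using L by (simp add: subgroup.m_closed)
      qed
    qed
    then show ?thesis using L by (auto simp: normal_inv_iff conj_set_def)
  qed
  ultimately show ?thesis using NL LK r(1) by blast
qed

lemma prime_power_series_abelian_factor:
  assumes D: "prime_power_series D" and K: "K \<lhd> G" "D \<subseteq> K" and ab: "derived G K \<subseteq> D"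
  shows "prime_power_series K"
proof -
  define P where "P L \<longleftrightarrow> prime_power_series L \<and> D \<subseteq> L \<and> L \<subseteq> K" for L
  have "P D" using D K by (simp add: P_def)
  moreover have "card L < Suc (card K)" if "P L" for L
    using that card_mono[of K L] finite_subgroup[OF normal_imp_subgroup[OF K(1)]] by (auto simp: P_def)
  ultimately obtain L where L: "P L" "\<And>M. P M \<Longrightarrow> card M \<le> card L"
    using ex_has_greatest_nat[of P D card "Suc (card K)"] by (metis less_imp_le)
  have "L = K"
  proof (rule ccontr)
    assume "L \<noteq> K"
    then have LK: "L \<subset> K" using L(1) by (auto simp: P_def)
    have Ln: "L \<lhd> G" using L(1) prime_power_series_normal by (auto simp: P_def)
    obtain M r k where M: "M \<lhd> G" "L \<subset> M" "M \<subseteq> K" "prime r" "card M = r ^ k * card L"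
      using abelian_factor_prime_power_step[OF Ln K(1) LK subset_trans[OF ab]] L(1) unfolding P_def by blast
    have "P M" using M L(1) prime_power_series.step[of L M r k] by (auto simp: P_def)
    moreover have "card L < card M"
      using M(2) finite_subgroup[OF normal_imp_subgroup[OF M(1)]] by (rule psubset_card_mono[rotated])
    ultimately show False using L(2) by fastforce
  qed
  then show ?thesis using L(1) by (simp add: P_def)
qed

theorem hall_dominates_solvable:
  assumes "solvable G"
  shows "hall_dominates \<pi>"
proof -
  obtain n where n: "(derived G ^^ n) (carrier G) = {\<one>}"
    using assms solvable_iff_trivial_derived_seq by blast
  have normal: "(derived G ^^ i) (carrier G) \<lhd> G" for i
    by (induction i) (simp_all add: normal_self derived_is_normal)
  have "prime_power_series ((derived G ^^ (n - i)) (carrier G))" if "i \<le> n" for i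
    using that
  proof (induction i)
    case 0
    then show ?case using n by (simp add: prime_power_series.one)
  next
    case (Suc i)
    define K where "K = (derived G ^^ (n - Suc i)) (carrier G)"
    have "n - i = Suc (n - Suc i)" using Suc.prems by simp
    then have D: "(derived G ^^ (n - i)) (carrier G) = derived G K" by (simp add: K_def)
    have K: "K \<lhd> G" unfolding K_def by (rule normal)
    have "derived G K \<subseteq> K" using derived_incl[of K K] normal_imp_subgroup[OF K] by simp
    then have "prime_power_series K"
      using prime_power_series_abelian_factor[of "derived G K" K] Suc K D by simp
    then show ?case by (simp add: K_def)
  qed
  from this[of n] have "prime_power_series (carrier G)" by simp
  then show ?thesis by (rule hall_dominates_prime_power_series)
qed

end


section \<open>Semidirect products with groups of automorphisms\<close>

text \<open>The acting group is a set \<open>L\<close> of extensional functions, so that the quotient of the circle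
  group by the kernel of \<open>\<lambda>\<close> appears as the image of \<open>\<lambda>\<close>.\<close>

locale automorphism_action = group A for A :: "('a, 'm) monoid_scheme" (structure) +
  fixes L :: "('a \<Rightarrow> 'a) set"
  assumes L_subgroup: "subgroup L (AutoGroup A)"
begin

definition semidirect :: "('a \<times> ('a \<Rightarrow> 'a)) monoid"
  where "semidirect = \<lparr>carrier = carrier A \<times> L,
    monoid.mult = (\<lambda>(a, f) (b, g). (a \<otimes> f b, compose (carrier A) f g)),
    monoid.one = (\<one>, \<lambda>x\<in>carrier A. x)\<rparr>"

lemma semidirect_simps [simp]:
  "carrier semidirect = carrier A \<times> L"
  "(a, f) \<otimes>\<^bsub>semidirect\<^esub> (b, g) = (a \<otimes> f b, compose (carrier A) f g)"
  "\<one>\<^bsub>semidirect\<^esub> = (\<one>, \<lambda>x\<in>carrier A. x)"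
  by (simp_all add: semidirect_def)

lemma L_auto: "f \<in> L \<Longrightarrow> f \<in> auto A"
  using subgroup.mem_carrier[OF L_subgroup] by (simp add: AutoGroup_def)

lemma AutoGroup_mult:
  "f \<in> auto A \<Longrightarrow> g \<in> auto A \<Longrightarrow> f \<otimes>\<^bsub>AutoGroup A\<^esub> g = compose (carrier A) f g"
  by (simp add: AutoGroup_def BijGroup_def auto_def)

lemma AutoGroup_one: "\<one>\<^bsub>AutoGroup A\<^esub> = (\<lambda>x\<in>carrier A. x)"
  by (simp add: AutoGroup_def BijGroup_def)

lemma L_closed [simp]: "f \<in> L \<Longrightarrow> x \<in> carrier A \<Longrightarrow> f x \<in> carrier A"
  using L_auto by (auto simp: auto_def hom_def)

lemma L_mult: "f \<in> L \<Longrightarrow> x \<in> carrier A \<Longrightarrow> y \<in> carrier A \<Longrightarrow> f (x \<otimes> y) = f x \<otimes> f y"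
  using L_auto by (auto simp: auto_def hom_def)

lemma L_one [simp]:
  assumes "f \<in> L"
  shows "f \<one> = \<one>"
proof -
  have "f \<one> \<otimes> f \<one> = f \<one>" using L_mult[OF assms, of \<one> \<one>] by simp
  then show ?thesis using L_closed[OF assms one_closed] l_cancel_one by blast
qed

lemma L_extensional: "f \<in> L \<Longrightarrow> f \<in> extensional (carrier A)"
  using L_auto by (auto simp: auto_def Bij_def)

lemma id_in_L [simp]: "(\<lambda>x\<in>carrier A. x) \<in> L"
  using subgroup.one_closed[OF L_subgroup] by (simp add: AutoGroup_one)

lemma compose_in_L [simp]: "f \<in> L \<Longrightarrow> g \<in> L \<Longrightarrow> compose (carrier A) f g \<in> L"
  using subgroup.m_closed[OF L_subgroup, of f g] by (simp add: AutoGroup_mult L_auto)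

lemma compose_id [simp]:
  assumes "f \<in> L"
  shows "compose (carrier A) f (\<lambda>x\<in>carrier A. x) = f"
    and "compose (carrier A) (\<lambda>x\<in>carrier A. x) f = f"
proof -
  have f: "f \<in> carrier A \<rightarrow> carrier A" using assms by simp
  show "compose (carrier A) f (\<lambda>x\<in>carrier A. x) = f"
    using f L_extensional[OF assms] by (rule compose_Id)
  show "compose (carrier A) (\<lambda>x\<in>carrier A. x) f = f"
    using f L_extensional[OF assms] by (rule Id_compose)
qed

lemma L_inverse:
  assumes "f \<in> L"
  obtains g where "g \<in> L" "compose (carrier A) g f = (\<lambda>x\<in>carrier A. x)"
    "compose (carrier A) f g = (\<lambda>x\<in>carrier A. x)"
proof -
  interpret Aut: group "AutoGroup A" by (rule AutoGroup)
  have f: "f \<in> carrier (AutoGroup A)" using subgroup.mem_carrier[OF L_subgroup assms] .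
  have g: "inv\<^bsub>AutoGroup A\<^esub> f \<in> L" using subgroup.m_inv_closed[OF L_subgroup assms] .
  show thesis
  proof (rule that[OF g])
    show "compose (carrier A) (inv\<^bsub>AutoGroup A\<^esub> f) f = (\<lambda>x\<in>carrier A. x)"
      unfolding AutoGroup_mult[OF L_auto[OF g] L_auto[OF assms], symmetric] AutoGroup_one[symmetric]
      using f by (rule Aut.l_inv)
    show "compose (carrier A) f (inv\<^bsub>AutoGroup A\<^esub> f) = (\<lambda>x\<in>carrier A. x)"
      unfolding AutoGroup_mult[OF L_auto[OF assms] L_auto[OF g], symmetric] AutoGroup_one[symmetric]
      using f by (rule Aut.r_inv)
  qed
qed

lemma L_compose_assoc:
  "f \<in> L \<Longrightarrow> g \<in> L \<Longrightarrow> h \<in> L \<Longrightarrow>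
    compose (carrier A) (compose (carrier A) f g) h = compose (carrier A) f (compose (carrier A) g h)"
  by (rule compose_assoc[symmetric]) auto

lemma group_semidirect: "group semidirect"
proof (rule groupI)
  fix x assume "x \<in> carrier semidirect"
  then obtain a f where x: "x = (a, f)" "a \<in> carrier A" "f \<in> L" by auto
  obtain g where g: "g \<in> L" "compose (carrier A) g f = (\<lambda>x\<in>carrier A. x)"
    using L_inverse[OF x(3)] by blast
  have "g (inv a) \<otimes> g a = \<one>" using g x by (simp flip: L_mult)
  then show "\<exists>y\<in>carrier semidirect. y \<otimes>\<^bsub>semidirect\<^esub> x = \<one>\<^bsub>semidirect\<^esub>"
    using g x by (intro bexI[of _ "(g (inv a), g)"]) auto
next
  fix x y z assume "x \<in> carrier semidirect" "y \<in> carrier semidirect" "z \<in> carrier semidirect"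
  then obtain a f b g c h where "x = (a, f)" "a \<in> carrier A" "f \<in> L"
    "y = (b, g)" "b \<in> carrier A" "g \<in> L" "z = (c, h)" "c \<in> carrier A" "h \<in> L"
    by auto
  then show "x \<otimes>\<^bsub>semidirect\<^esub> y \<otimes>\<^bsub>semidirect\<^esub> z = x \<otimes>\<^bsub>semidirect\<^esub> (y \<otimes>\<^bsub>semidirect\<^esub> z)"
    by (simp add: L_compose_assoc L_mult m_assoc compose_eq)
qed auto

lemma finite_group_semidirect:
  assumes "finite (carrier A)"
  shows "finite_group semidirect"
proof -
  have "L \<subseteq> (carrier A) \<rightarrow>\<^sub>E (carrier A)"
    using L_extensional by (auto simp: PiE_def)
  then have "finite L" using assms finite_PiE[of "carrier A" "\<lambda>_. carrier A"] finite_subset by blast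
  then show ?thesis
    using assms group_semidirect by (simp add: finite_group_def finite_group_axioms_def)
qed

lemma solvable_semidirect:
  assumes "solvable A" "solvable (AutoGroup A\<lparr>carrier := L\<rparr>)"
  shows "solvable semidirect"
proof -
  let ?Q = "AutoGroup A\<lparr>carrier := L\<rparr>"
  have Q: "group ?Q" by (rule group.subgroup_imp_group[OF AutoGroup L_subgroup])
  have 1: "group_hom A semidirect (\<lambda>a. (a, \<lambda>x\<in>carrier A. x))"
    unfolding group_hom_def group_hom_axioms_def
    using group_semidirect group_axioms by (auto simp: hom_def)
  have 2: "group_hom semidirect ?Q snd"
    unfolding group_hom_def group_hom_axioms_def
    using group_semidirect Q by (auto simp: hom_def AutoGroup_mult L_auto)
  show ?thesis
  proof (rule solvable_condition[OF 1 2 _ _ assms])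
    show "snd ` carrier semidirect = carrier ?Q" by force
    show "kernel semidirect ?Q snd \<subseteq> (\<lambda>a. (a, \<lambda>x\<in>carrier A. x)) ` carrier A"
      by (auto simp: kernel_def AutoGroup_one)
  qed
qed

lemma semidirect_conj_base:
  assumes "a \<in> carrier A" "f \<in> L" "x \<in> carrier A"
  shows "(a, f) \<otimes>\<^bsub>semidirect\<^esub> (x, \<lambda>x\<in>carrier A. x) \<otimes>\<^bsub>semidirect\<^esub> inv\<^bsub>semidirect\<^esub> (a, f) =
    (a \<otimes> f x \<otimes> inv a, \<lambda>x\<in>carrier A. x)"
proof -
  interpret S: group semidirect by (rule group_semidirect)
  have "(a, f) \<otimes>\<^bsub>semidirect\<^esub> (x, \<lambda>x\<in>carrier A. x) =
      (a \<otimes> f x \<otimes> inv a, \<lambda>x\<in>carrier A. x) \<otimes>\<^bsub>semidirect\<^esub> (a, f)"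
    using assms by (simp add: m_assoc)
  moreover have "(a, f) \<in> carrier semidirect"
    "(a \<otimes> f x \<otimes> inv a, \<lambda>x\<in>carrier A. x) \<in> carrier semidirect"
    using assms by simp_all
  ultimately show ?thesis by (simp only: S.m_assoc S.inv_closed S.r_inv S.r_one)
qed

lemma subgroup_base:
  assumes "subgroup P A"
  shows "subgroup (P \<times> {\<lambda>x\<in>carrier A. x}) semidirect"
proof -
  interpret P: subgroup P A by fact
  interpret S: group semidirect by (rule group_semidirect)
  show ?thesis
  proof (rule S.subgroupI)
    fix z assume "z \<in> P \<times> {\<lambda>x\<in>carrier A. x}"
    then obtain a where a: "z = (a, \<lambda>x\<in>carrier A. x)" "a \<in> P" by auto
    then have "inv\<^bsub>semidirect\<^esub> z = (inv a, \<lambda>x\<in>carrier A. x)"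
      by (intro S.inv_equality) auto
    then show "inv\<^bsub>semidirect\<^esub> z \<in> P \<times> {\<lambda>x\<in>carrier A. x}" using a by simp
  next
    show "P \<times> {\<lambda>x\<in>carrier A. x} \<noteq> {}" using P.one_closed by blast
  qed auto
qed

lemma subgroup_invariant_times:
  assumes "subgroup P A" and inv: "\<And>f x. f \<in> L \<Longrightarrow> x \<in> P \<Longrightarrow> f x \<in> P"
  shows "subgroup (P \<times> L) semidirect"
proof -
  interpret P: subgroup P A by fact
  interpret S: group semidirect by (rule group_semidirect)
  show ?thesis
  proof (rule S.subgroupI)
    fix z assume "z \<in> P \<times> L"
    then obtain a f where z: "z = (a, f)" "a \<in> P" "f \<in> L" by auto
    obtain g where g: "g \<in> L" "compose (carrier A) g f = (\<lambda>x\<in>carrier A. x)"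
      using L_inverse[OF z(3)] by blast
    have "g (inv a) \<otimes> g a = \<one>" using g z by (simp flip: L_mult)
    then have "inv\<^bsub>semidirect\<^esub> z = (g (inv a), g)"
      using g z by (intro S.inv_equality) auto
    then show "inv\<^bsub>semidirect\<^esub> z \<in> P \<times> L" using g z inv by simp
  next
    show "P \<times> L \<noteq> {}" using P.one_closed id_in_L by blast
  qed (use inv in auto)
qed

lemma subgroup_L: "subgroup ({\<one>} \<times> L) semidirect"
  by (rule subgroup_invariant_times[OF triv_subgroup]) simp

end


section \<open>Hall left ideals\<close>

lemma subgroup_opp_group_iff: "subgroup H (opp_group G) \<longleftrightarrow> subgroup H G"
  by (auto simp: subgroup_def)

lemma (in group) solvable_opp_group:
  assumes "solvable G"
  shows "solvable (opp_group G)"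
proof -
  have hom: "group_hom G (opp_group G) (\<lambda>x. inv x)"
    unfolding group_hom_def group_hom_axioms_def
    using group_axioms group_opp_group by (auto simp: hom_def inv_mult_group)
  have "(\<lambda>x. inv x) ` carrier G = carrier (opp_group G)"
  proof
    show "carrier (opp_group G) \<subseteq> (\<lambda>x. inv x) ` carrier G"
      by (metis image_eqI inv_closed inv_inv opp_group_simps(1) subsetI)
  qed auto
  then show ?thesis using group_hom.surj_hom_imp_solvable[OF hom] assms by simp
qed

context skew_brace
begin

definition lam_image :: "('a \<Rightarrow> 'a) set"
  where "lam_image = lam A M ` carrier M"

lemma lam_group_hom: "group_hom M (AutoGroup A) (lam A M)"
  using lam_hom A.AutoGroup M.group_axioms by (simp add: group_hom_def group_hom_axioms_def)

lemma subgroup_lam_image: "subgroup lam_image (AutoGroup A)"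
  unfolding lam_image_def by (rule group_hom.img_is_subgroup[OF lam_group_hom])

sublocale action: automorphism_action A lam_image
  by (simp add: automorphism_action_def automorphism_action_axioms_def A.is_group subgroup_lam_image)

lemma lam_image_group_hom: "group_hom M (AutoGroup A\<lparr>carrier := lam_image\<rparr>) (lam A M)"
  using lam_hom M.group_axioms group.subgroup_imp_group[OF A.AutoGroup subgroup_lam_image]
  by (auto simp: group_hom_def group_hom_axioms_def hom_def lam_image_def)

lemma card_lam_image: "card lam_image = order (M Mod lam_ker A M)"
proof -
  have "kernel M (AutoGroup A\<lparr>carrier := lam_image\<rparr>) (lam A M) = lam_ker A M"
    by (simp add: lam_ker_def kernel_def)
  then have "order (M Mod lam_ker A M) = order (AutoGroup A\<lparr>carrier := lam_image\<rparr>)"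
    using iso_same_order[OF group_hom.FactGroup_iso_set[OF lam_image_group_hom]]
    by (simp add: lam_image_def)
  then show ?thesis by (simp add: order_def)
qed

lemma solvable_lam_image: "solvable M \<Longrightarrow> solvable (AutoGroup A\<lparr>carrier := lam_image\<rparr>)"
  using group_hom.surj_hom_imp_solvable[OF lam_image_group_hom] by (simp add: lam_image_def)

lemma M_mult_eq: "a \<in> carrier A \<Longrightarrow> b \<in> carrier A \<Longrightarrow> a \<otimes>\<^bsub>M\<^esub> b = a \<otimes>\<^bsub>A\<^esub> lam A M a b"
  by (simp add: lam_def M_closed flip: A.m_assoc)

lemma left_ideal_sub_skew_brace:
  assumes "left_ideal I A M"
  shows "sub_skew_brace I A M"
proof -
  have I: "subgroup I A" and lamI: "\<And>a x. a \<in> carrier A \<Longrightarrow> x \<in> I \<Longrightarrow> lam A M a x \<in> I"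
    using assms by (auto simp: left_ideal_def carrier_eq)
  interpret I: subgroup I A by fact
  have "subgroup I M"
  proof (rule M.subgroupI)
    show "I \<subseteq> carrier M" using I.subset carrier_eq by simp
    show "I \<noteq> {}" using I.one_closed by blast
    fix x assume x: "x \<in> I"
    define y where "y = inv\<^bsub>M\<^esub> x"
    have xA: "x \<in> carrier A" and y: "y \<in> carrier A" 
      using x I.subset carrier_eq M.inv_closed[of x] by (auto simp: y_def)
    \<comment> \<open>In additive notation, \<open>y \<circ> x = 0\<close> reads \<open>y + \<lambda>\<^sub>y(x) = 0\<close>.\<close>
    have "y \<otimes>\<^bsub>A\<^esub> lam A M y x = \<one>\<^bsub>A\<^esub>"
      using M_mult_eq[OF y xA] xA carrier_eq one_eq by (simp add: y_def)
    then have "y = inv\<^bsub>A\<^esub> (lam A M y x)"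
      using y xA lamI[OF y x] by (intro A.inv_equality[symmetric]) auto
    then show "inv\<^bsub>M\<^esub> x \<in> I"
      unfolding y_def[symmetric] using I.m_inv_closed[OF lamI[OF y x]] by metis
  next
    fix x y assume "x \<in> I" "y \<in> I"
    then show "x \<otimes>\<^bsub>M\<^esub> y \<in> I" using lamI by (simp add: M_mult_eq)
  qed
  then show ?thesis using I by (simp add: sub_skew_brace_def)
qed

text \<open>Let \<open>S\<close> be the semidirect product of the additive group with \<open>\<Lambda>\<close>, the image of \<open>\<lambda>\<close>.  If a Hall
  \<open>\<pi>\<close>-subgroup \<open>T\<close> of \<open>S\<close> contains \<open>\<Lambda>\<close> and \<open>P\<close>, then the additive part of \<open>T\<close> is a \<open>\<Lambda>\<close>-invariant Hall
  subgroup containing \<open>P\<close>, as desired.  The two alternatives for \<open>P\<close> say that it is a left ideal of the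
  skew brace, or of its opposite.

  In the first case, \<open>P \<Lambda>\<close> is a \<open>\<pi>\<close>-subgroup of \<open>S\<close>.  In the second case it need not be a
  subgroup.  However, conjugation by the pair \<open>d = (a, \<lambda>\<^sub>a)\<close> acts on the additive group as \<open>x \<mapsto> a + \<lambda>\<^sub>a(x) - a\<close>,
  the lambda map of the opposite skew brace, and so it preserves \<open>P\<close>; moreover every element of \<open>S\<close> is
  a product \<open>dl\<close> of such a pair and some \<open>l \<in> \<Lambda>\<close>.  Now let \<open>T\<^sub>1\<close> be a Hall subgroup containing \<open>P\<close>, and
  let \<open>g = dl\<close> move \<open>\<Lambda>\<close> into \<open>T\<^sub>1\<close>.  Since \<open>l\<close> normalizes \<open>\<Lambda>\<close>, already \<open>d\<close> moves \<open>\<Lambda>\<close> into \<open>T\<^sub>1\<close>; and \<open>d\<close> leaves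
  \<open>P\<close> inside \<open>T\<^sub>1\<close>.  Undoing the conjugation by \<open>d\<close> turns \<open>T\<^sub>1\<close> into a Hall subgroup that contains
  both.\<close>

theorem hall_left_ideal_exists:
  assumes fin: "finite (carrier A)"
    and dom: "finite_group.hall_dominates action.semidirect \<pi>"
    and L: "pi_number \<pi> (card lam_image)"
    and P: "subgroup P A" "pi_number \<pi> (card P)"
    and inv: "(\<forall>a\<in>carrier A. \<forall>x\<in>P. inv\<^bsub>A\<^esub> a \<otimes>\<^bsub>A\<^esub> (a \<otimes>\<^bsub>M\<^esub> x) \<in> P) \<or>
      (\<forall>a\<in>carrier A. \<forall>x\<in>P. (a \<otimes>\<^bsub>M\<^esub> x) \<otimes>\<^bsub>A\<^esub> inv\<^bsub>A\<^esub> a \<in> P)"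
  shows "\<exists>I. left_ideal I A M \<and> P \<subseteq> I \<and> card I = Max {d. d dvd order A \<and> pi_number \<pi> d}"
proof -
  interpret S: finite_group action.semidirect
    using fin by (rule action.finite_group_semidirect)
  interpret P: subgroup P A by fact
  let ?id = "\<lambda>x\<in>carrier A. x"
  let ?base = "\<lambda>X. X \<times> {?id}"
  let ?\<Lambda> = "{\<one>\<^bsub>A\<^esub>} \<times> lam_image"
  have base_sub: "?base X \<subseteq> carrier action.semidirect" if "X \<subseteq> carrier A" for X
    using that by auto
  obtain T0 where T0: "S.hall_subgroup \<pi> T0 (carrier action.semidirect)"
    and dom0: "\<And>U. subgroup U action.semidirect \<Longrightarrow> pi_number \<pi> (card U) \<Longrightarrow>
      \<exists>g\<in>carrier action.semidirect. S.conj_set g U \<subseteq> T0"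
    using dom unfolding S.hall_dominates_def by blast
  have hall_conj: "S.hall_subgroup \<pi> (S.conj_set g T) (carrier action.semidirect)"
    if "g \<in> carrier action.semidirect" "S.hall_subgroup \<pi> T (carrier action.semidirect)" for g T
    using S.hall_subgroup_conj_set[OF that(2) S.subgroup_self that(1)]
      S.conj_set_member[OF S.subgroup_self that(1)] by simp
  have "\<exists>T. S.hall_subgroup \<pi> T (carrier action.semidirect) \<and> ?base P \<subseteq> T \<and> ?\<Lambda> \<subseteq> T"
    using inv
  proof
    assume *: "\<forall>a\<in>carrier A. \<forall>x\<in>P. inv\<^bsub>A\<^esub> a \<otimes>\<^bsub>A\<^esub> (a \<otimes>\<^bsub>M\<^esub> x) \<in> P"
    have U: "subgroup (P \<times> lam_image) action.semidirect"
      using * by (intro action.subgroup_invariant_times[OF P(1)]) (auto simp: lam_image_def lam_def carrier_eq)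
    have "pi_number \<pi> (card (P \<times> lam_image))"
      using P L by (simp add: card_cartesian_product pi_number_mult_iff)
    then obtain g where g: "g \<in> carrier action.semidirect" "S.conj_set g (P \<times> lam_image) \<subseteq> T0"
      using dom0 U by blast
    then have "P \<times> lam_image \<subseteq> S.conj_set (inv\<^bsub>action.semidirect\<^esub> g) T0"
      using S.conj_set_subset_iff[OF g(1) subgroup.subset[OF U] subgroup.subset[OF S.hall_subgroupD(1)[OF T0]]]
      by simp
    then show ?thesis
      using hall_conj[OF S.inv_closed[OF g(1)] T0] P.one_closed action.id_in_L by blast
  next
    assume *: "\<forall>a\<in>carrier A. \<forall>x\<in>P. (a \<otimes>\<^bsub>M\<^esub> x) \<otimes>\<^bsub>A\<^esub> inv\<^bsub>A\<^esub> a \<in> P"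
    have baseP: "subgroup (?base P) action.semidirect" using P(1) by (rule action.subgroup_base)
    have "pi_number \<pi> (card (?base P))" using P by (simp add: card_cartesian_product)
    then obtain h where h: "h \<in> carrier action.semidirect" "S.conj_set h (?base P) \<subseteq> T0"
      using dom0 baseP by blast
    define T1 where "T1 = S.conj_set (inv\<^bsub>action.semidirect\<^esub> h) T0"
    have T1: "S.hall_subgroup \<pi> T1 (carrier action.semidirect)"
      unfolding T1_def using S.inv_closed[OF h(1)] T0 by (rule hall_conj)
    have PT1: "?base P \<subseteq> T1"
      using S.conj_set_subset_iff[OF h(1) subgroup.subset[OF baseP] subgroup.subset[OF S.hall_subgroupD(1)[OF T0]]] h(2)
      by (simp add: T1_def)
    have "pi_number \<pi> (card ?\<Lambda>)" using L by (simp add: card_cartesian_product)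
    then obtain k where k: "k \<in> carrier action.semidirect" "S.conj_set k ?\<Lambda> \<subseteq> T0"
      using dom0 action.subgroup_L by blast
    define g where "g = inv\<^bsub>action.semidirect\<^esub> h \<otimes>\<^bsub>action.semidirect\<^esub> k"
    have \<Lambda>: "?\<Lambda> \<subseteq> carrier action.semidirect" using subgroup.subset[OF action.subgroup_L] .
    have g: "g \<in> carrier action.semidirect" unfolding g_def using h k by (intro S.m_closed S.inv_closed)
    have "S.conj_set g ?\<Lambda> = S.conj_set (inv\<^bsub>action.semidirect\<^esub> h) (S.conj_set k ?\<Lambda>)"
      unfolding g_def using h k \<Lambda> by (intro S.conj_set_conj_set[symmetric] S.inv_closed)
    then have g\<Lambda>: "S.conj_set g ?\<Lambda> \<subseteq> T1"
      using S.conj_set_mono[OF k(2)] by (simp add: T1_def)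
    obtain a f where af: "g = (a, f)" "a \<in> carrier A" "f \<in> lam_image" using g by auto
    \<comment> \<open>With \<open>e\<close> the inverse of \<open>\<lambda>\<^sub>a\<close>, the factorization is \<open>(a, f) = (a, \<lambda>\<^sub>a) (0, e f)\<close>.\<close>
    define d where "d = (a, lam A M a)"
    have la: "lam A M a \<in> lam_image" using af carrier_eq by (simp add: lam_image_def)
    have d: "d \<in> carrier action.semidirect" using af la by (simp add: d_def)
    obtain e where e: "e \<in> lam_image" "compose (carrier A) (lam A M a) e = ?id"
      using action.L_inverse[OF la] by blast
    define l where "l = (\<one>\<^bsub>A\<^esub>, compose (carrier A) e f)"
    have l: "l \<in> ?\<Lambda>" using e af by (simp add: l_def)
    have "g = d \<otimes>\<^bsub>action.semidirect\<^esub> l"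
      using af e la action.L_compose_assoc[OF la e(1) af(3)] by (simp add: d_def l_def)
    then have "S.conj_set g ?\<Lambda> = S.conj_set d (S.conj_set l ?\<Lambda>)"
      using d l \<Lambda> S.conj_set_conj_set[of d l ?\<Lambda>] by blast
    also have "S.conj_set l ?\<Lambda> = ?\<Lambda>" using action.subgroup_L l by (rule S.conj_set_member)
    finally have d\<Lambda>: "S.conj_set d ?\<Lambda> \<subseteq> T1" using g\<Lambda> by simp
    have dP: "S.conj_set d (?base P) \<subseteq> ?base P"
    proof
      fix z assume "z \<in> S.conj_set d (?base P)"
      then obtain x where x: "x \<in> P"
        "z = d \<otimes>\<^bsub>action.semidirect\<^esub> (x, ?id) \<otimes>\<^bsub>action.semidirect\<^esub> inv\<^bsub>action.semidirect\<^esub> d"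
        by (auto simp: S.conj_set_def)
      have xA: "x \<in> carrier A" using x by simp
      have "z = (a \<otimes>\<^bsub>A\<^esub> lam A M a x \<otimes>\<^bsub>A\<^esub> inv\<^bsub>A\<^esub> a, ?id)"
        unfolding x(2) d_def using af(2) la xA by (rule action.semidirect_conj_base)
      also have "a \<otimes>\<^bsub>A\<^esub> lam A M a x = a \<otimes>\<^bsub>M\<^esub> x" using M_mult_eq[OF af(2) xA] by simp
      finally show "z \<in> ?base P" using * af(2) x(1) by blast
    qed
    define T where "T = S.conj_set (inv\<^bsub>action.semidirect\<^esub> d) T1"
    have T1c: "T1 \<subseteq> carrier action.semidirect" using T1 by (rule S.hall_subgroupD)
    have "?\<Lambda> \<subseteq> T"
      unfolding T_def using S.conj_set_subset_iff[OF d \<Lambda> T1c] d\<Lambda> by blast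
    moreover have "?base P \<subseteq> T"
      unfolding T_def using S.conj_set_subset_iff[OF d subgroup.subset[OF baseP] T1c] dP PT1 by blast
    moreover have "S.hall_subgroup \<pi> T (carrier action.semidirect)"
      unfolding T_def using d T1 by (intro hall_conj S.inv_closed)
    ultimately show ?thesis by blast
  qed
  then obtain T where T: "S.hall_subgroup \<pi> T (carrier action.semidirect)" and PT: "?base P \<subseteq> T" and LT: "?\<Lambda> \<subseteq> T"
    by blast
  interpret T: subgroup T action.semidirect using T by (rule S.hall_subgroupD)
  define I where "I = {b \<in> carrier A. (b, ?id) \<in> T}"
  have I: "subgroup I A"
  proof (rule A.subgroupI)
    show "I \<subseteq> carrier A" by (auto simp: I_def)
    show "I \<noteq> {}" using T.one_closed by (auto simp: I_def)
    fix b assume b: "b \<in> I"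
    then have "inv\<^bsub>action.semidirect\<^esub> (b, ?id) = (inv\<^bsub>A\<^esub> b, ?id)"
      by (intro S.inv_equality) (auto simp: I_def)
    then show "inv\<^bsub>A\<^esub> b \<in> I" using T.m_inv_closed[of "(b, ?id)"] b by (simp add: I_def)
    fix c assume "c \<in> I"
    then show "b \<otimes>\<^bsub>A\<^esub> c \<in> I" using T.m_closed[of "(b, ?id)" "(c, ?id)"] b by (simp add: I_def)
  qed
  have "lam A M a x \<in> I" if a: "a \<in> carrier A" and x: "x \<in> I" for a x
  proof -
    have la: "lam A M a \<in> lam_image" using a carrier_eq by (simp add: lam_image_def)
    then have t: "(\<one>\<^bsub>A\<^esub>, lam A M a) \<in> T" using LT by blast
    have xA: "x \<in> carrier A" using x by (simp add: I_def)
    have "(\<one>\<^bsub>A\<^esub>, lam A M a) \<otimes>\<^bsub>action.semidirect\<^esub> (x, ?id) \<otimes>\<^bsub>action.semidirect\<^esub>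
        inv\<^bsub>action.semidirect\<^esub> (\<one>\<^bsub>A\<^esub>, lam A M a) \<in> T"
      using t x by (intro T.m_closed T.m_inv_closed) (simp_all add: I_def)
    then show ?thesis
      unfolding action.semidirect_conj_base[OF A.one_closed la xA] using la xA by (simp add: I_def)
  qed
  then have left: "left_ideal I A M" using I by (auto simp: left_ideal_def carrier_eq)
  have "P \<subseteq> I" using PT by (auto simp: I_def)
  moreover have "card I = Max {d. d dvd order A \<and> pi_number \<pi> d}"
  proof -
    have base: "subgroup (?base (carrier A)) action.semidirect"
      using A.subgroup_self by (rule action.subgroup_base)
    have "S.conj_set g (?base (carrier A)) = ?base (carrier A)" if g: "g \<in> carrier action.semidirect" for g
    proof (rule S.conj_set_eqI[OF g base_sub[OF subset_refl]])
      obtain a f where "g = (a, f)" "a \<in> carrier A" "f \<in> lam_image" using g by auto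
      then show "S.conj_set g (?base (carrier A)) \<subseteq> ?base (carrier A)"
        by (auto simp: S.conj_set_def action.semidirect_conj_base simp del: action.semidirect_simps(2))
    qed
    then have "S.hall_subgroup \<pi> (T \<inter> ?base (carrier A)) (?base (carrier A))"
      using S.hall_subgroup_Int_normal[OF S.subgroup_self T base base_sub[OF subset_refl]] by blast
    moreover have "T \<inter> ?base (carrier A) = ?base I" by (auto simp: I_def)
    ultimately show ?thesis
      using S.card_hall_subgroup[of \<pi> "?base I" "?base (carrier A)"]
      by (simp add: card_cartesian_product order_def)
  qed
  ultimately show ?thesis using left by blast
qed

end

theorem lemma7:
  fixes A :: "('a, 'm) monoid_scheme" and M :: "('a, 'n) monoid_scheme"
  assumes "skew_brace A M" and "finite (carrier A)"
  shows
    "(\<forall>p P. prime p \<longrightarrow>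
        p_group p (M Mod lam_ker A M) \<or> p_group p (M Mod lam_ker (opp_group A) M) \<longrightarrow>
        left_ideal P A M \<longrightarrow> (\<exists>k. card P = p ^ k) \<longrightarrow>
        (\<exists>P2. sylow_sub_skew_brace p P2 A M \<and> P \<subseteq> P2 \<and>
          (left_ideal P2 A M \<or> left_ideal P2 (opp_group A) M))) \<and>
     (\<forall>\<pi> P. (\<forall>q\<in>\<pi>. prime q) \<longrightarrow>
        solvable A \<longrightarrow> solvable M \<longrightarrow>
        pi_group \<pi> (M Mod lam_ker A M) \<or> pi_group \<pi> (M Mod lam_ker (opp_group A) M) \<longrightarrow>
        left_ideal P A M \<longrightarrow> pi_number \<pi> (card P) \<longrightarrow>
        (\<exists>P2. hall_sub_skew_brace \<pi> P2 A M \<and> P \<subseteq> P2 \<and>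
          (left_ideal P2 A M \<or> left_ideal P2 (opp_group A) M)))"
proof -
  interpret B: skew_brace A M by fact
  interpret O: skew_brace "opp_group A" M by (rule B.skew_brace_opp)
  note fin = assms(2)
  interpret BS: finite_group B.action.semidirect using fin by (rule B.action.finite_group_semidirect)
  interpret OS: finite_group O.action.semidirect using fin by (intro O.action.finite_group_semidirect) simp
  have main: "\<exists>I. sub_skew_brace I A M \<and> card I = Max {d. d dvd order A \<and> pi_number \<pi> d} \<and> P \<subseteq> I \<and>
      (left_ideal I A M \<or> left_ideal I (opp_group A) M)"
    if dom: "BS.hall_dominates \<pi>" "OS.hall_dominates \<pi>"
      and grp: "pi_number \<pi> (order (M Mod lam_ker A M)) \<or> pi_number \<pi> (order (M Mod lam_ker (opp_group A) M))"
      and P: "left_ideal P A M" "pi_number \<pi> (card P)" for \<pi> P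
    using grp
  proof
    have PA: "subgroup P A" and lamP: "\<And>a x. a \<in> carrier A \<Longrightarrow> x \<in> P \<Longrightarrow> inv\<^bsub>A\<^esub> a \<otimes>\<^bsub>A\<^esub> (a \<otimes>\<^bsub>M\<^esub> x) \<in> P"
      using P(1) by (auto simp: left_ideal_def B.carrier_eq lam_def image_subset_iff subgroup.mem_carrier)
    {
      assume "pi_number \<pi> (order (M Mod lam_ker A M))"
      then obtain I where "left_ideal I A M" "P \<subseteq> I" "card I = Max {d. d dvd order A \<and> pi_number \<pi> d}"
        using B.hall_left_ideal_exists[OF fin dom(1) _ PA P(2)] lamP by (auto simp: B.card_lam_image)
      then show ?thesis using B.left_ideal_sub_skew_brace by blast
    next
      assume "pi_number \<pi> (order (M Mod lam_ker (opp_group A) M))"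
      then obtain I where I: "left_ideal I (opp_group A) M" "P \<subseteq> I"
          "card I = Max {d. d dvd order (opp_group A) \<and> pi_number \<pi> d}"
        using O.hall_left_ideal_exists[OF _ dom(2) _ _ P(2)] fin PA lamP
        by (auto simp: O.card_lam_image subgroup_opp_group_iff)
      have "sub_skew_brace I A M"
        using O.left_ideal_sub_skew_brace[OF I(1)] by (simp add: sub_skew_brace_def subgroup_opp_group_iff)
      then show ?thesis using I by (auto simp: order_def)
    }
  qed
  show ?thesis
  proof (intro conjI allI impI)
    fix p :: nat and P
    assume p: "prime p" and grp: "p_group p (M Mod lam_ker A M) \<or> p_group p (M Mod lam_ker (opp_group A) M)"
      and P: "left_ideal P A M" "\<exists>k. card P = p ^ k"
    show "\<exists>P2. sylow_sub_skew_brace p P2 A M \<and> P \<subseteq> P2 \<and> (left_ideal P2 A M \<or> left_ideal P2 (opp_group A) M)"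
      using main[OF BS.hall_dominates_prime[OF p] OS.hall_dominates_prime[OF p] _ P(1)] grp P(2)
      unfolding p_group_def sylow_sub_skew_brace_def pi_number_singleton_iff[OF p] by blast
  next
    fix \<pi> P
    assume sol: "solvable A" "solvable M"
      and grp: "pi_group \<pi> (M Mod lam_ker A M) \<or> pi_group \<pi> (M Mod lam_ker (opp_group A) M)"
      and P: "left_ideal P A M" "pi_number \<pi> (card P)"
    have "solvable B.action.semidirect" "solvable O.action.semidirect"
      using sol B.A.solvable_opp_group
      by (auto intro: B.action.solvable_semidirect O.action.solvable_semidirect B.solvable_lam_image O.solvable_lam_image)
    then show "\<exists>P2. hall_sub_skew_brace \<pi> P2 A M \<and> P \<subseteq> P2 \<and> (left_ideal P2 A M \<or> left_ideal P2 (opp_group A) M)"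
      using main[OF BS.hall_dominates_solvable OS.hall_dominates_solvable _ P] grp
      unfolding pi_group_def hall_sub_skew_brace_def by blast
  qed
qed

end
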